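(* Let $n\geq 1$, $q\in(0,1)$ and $a\in\mathbb{R}^n_{>0}$. Then the intertwining relation $K_nM_n=L_nK_n$ holds, i.e. for every $\lambda\in\Lambda_n$ and every $\tilde Z\in\mathbb{K}^{2n}$, \[\sum_{Z\in\mathbb{K}^{2n}}K_n(\lambda,Z)M_n(Z,\tilde Z)=\sum_{\mu\in\Lambda_n}L_n(\lambda,\mu)K_n(\mu,\tilde Z).\]
   Context: Partitions: $\Lambda_l$ is the set of weakly decreasing $l$-tuples of nonnegative integers; $|x|=\sum_i x_i$; $e_i$ is the $i$-th unit vector. For tuples $x,y$ of nonnegative integers (with coordinates beyond their length taken to be $0$), write $x\preceq y$ if $y_i\geq x_i\geq y_{i+1}$ for all $i$. A symplectic Gelfand–Tsetlin pattern with $2n$ levels is $Z=(z^1,\dots,z^{2n})$ with $z^{2l-1},z^{2l}\in\Lambda_l$ for $1\le l\le n$ and $z^1\preceq z^2\preceq\dots\preceq z^{2n}$; the set of these is $\mathbb{K}^{2n}$. The alphabet is $[n,\bar n]=\{1<\bar 1<\dots<n<\bar n\}$ with $\mathrm{order}(l)=2l-1$, $\mathrm{order}(\bar l)=2l$; set $a_{\bar l}=a_l^{-1}$. $q$-binomials: $(q;q)_k=\prod_{j=1}^k(1-q^j)$, $\binom{N}{k}_q=\frac{(q;q)_N}{(q;q)_k(q;q)_{N-k}}$. Weights: $a^Z=\prod_{i=1}^n a_i^{2|z^{2i-1}|-|z^{2i}|-|z^{2i-2}|}$ (with $|z^0|=0$), and $\kappa_n(Z)=\prod_{k=1}^n\Big[\Big(\prod_{i=1}^{k-1}\binom{z^{2k-1}_i-z^{2k-1}_{i+1}}{z^{2k-1}_i-z^{2k-2}_i}_q\binom{z^{2k}_i-z^{2k}_{i+1}}{z^{2k}_i-z^{2k-1}_i}_q\Big)\binom{z^{2k}_k}{z^{2k}_k-z^{2k-1}_k}_q\Big]$.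 $K_n(\lambda,Z)=a^Z\kappa_n(Z)\mathbb{1}_{z^{2n}=\lambda}$. Kernel $L_n$ on $\Lambda_n$: $L_n(\lambda,\lambda+e_i)=u^+_{n,i}(\lambda)$, $L_n(\lambda,\lambda-e_i)=u^-_{n,i}(\lambda)$ ($1\le i\le n$), $0$ otherwise, where $u^+_{n,1}=1$, $u^+_{n,i}(\lambda)=1-q^{\lambda_{i-1}-\lambda_i}$ for $1<i\le n$, $u^-_{n,i}(\lambda)=1-q^{\lambda_i-\lambda_{i+1}}$ for $1\le i<n$, $u^-_{n,n}(\lambda)=1-q^{\lambda_n}$. Quantities: for interlacing $x\preceq y$ (with $x,y\in\Lambda_l$ or $x\in\Lambda_{l-1},y\in\Lambda_l$), $r_i(y;x)=q^{y_i-x_i}\frac{1-q^{x_{i-1}-y_i}}{1-q^{x_{i-1}-x_i}}$, $l_i(y;x)=q^{x_i-y_{i+1}}\frac{1-q^{y_{i+1}-x_{i+1}}}{1-q^{x_i-x_{i+1}}}$, with $x_0=+\infty$ (so $q^{x_0-\cdot}=0$) and coordinates beyond the length equal to $0$. $q$-Berele insertion: inserting letter $l$ into $Z\in\mathbb{K}^{2n}$ makes particle $z^k_1$, $k=\mathrm{order}(l)$, attempt a right jump (increase by $1$). Moves propagate level by level downward; all probabilities $r_i(z^{k+1};z^k)$, $l_i(z^{k+1};z^k)$ are evaluated at the configuration of levels $k,k+1$ before the move of $z^k_i$. If $z^k_i$ attempts a right jump: if $k=2n$ the jump is performed; if $k$ is odd and $i=(k+1)/2$, then with probability $r_i(z^{k+1};z^k)$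 the jump is performed and $z^{k+1}_i$ is pushed (attempts a right jump), and otherwise the jump is suppressed and $z^{k+1}_i$ is pulled left (performs a left jump); in all other cases the jump is performed and with probability $r_i(z^{k+1};z^k)$ $z^{k+1}_i$ is pushed (attempts a right jump), otherwise $z^{k+1}_{i+1}$ is pulled right (attempts a right jump). If $z^k_i$ performs a left jump (decrease by $1$) and $k<2n$, then with probability $l_i(z^{k+1};z^k)$ the particle $z^{k+1}_{i+1}$ performs a left jump, otherwise $z^{k+1}_i$ does. $I_l(Z,\tilde Z)$ denotes the resulting probability of ending at $\tilde Z$. Finally $M_n(Z,\tilde Z)=\sum_{l\in[n,\bar n]}a_lI_l(Z,\tilde Z)$. *)

theory Defs
  imports "HOL-Probability.Probability"
begin

text \<open>
  Tuples are 1-indexed functions \<open>nat \<Rightarrow> nat\<close>; the values at index 0 and beyond the length are fixed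
  to 0, so that a tuple of given length has a unique representation and coordinates beyond the
  length are 0. A pattern \<open>Z\<close> has \<open>Z k i\<close> as its \<open>i\<close>-th particle on level \<open>k\<close>, with the unused levels
  (0 and those above \<open>2 * n\<close>) fixed to the zero function.
\<close>

definition partitions :: "nat \<Rightarrow> (nat \<Rightarrow> nat) set" where
  "partitions l = {x. (\<forall>i. i \<notin> {1..l} \<longrightarrow> x i = 0) \<and> (\<forall>i\<in>{1..<l}. x (i + 1) \<le> x i)}"

definition psize :: "nat \<Rightarrow> (nat \<Rightarrow> nat) \<Rightarrow> nat" where
  "psize l x = (\<Sum>i=1..l. x i)"

definition interlaced :: "(nat \<Rightarrow> nat) \<Rightarrow> (nat \<Rightarrow> nat) \<Rightarrow> bool" (infix "\<preceq>" 50) where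
  "x \<preceq> y \<longleftrightarrow> (\<forall>i\<ge>1. x i \<le> y i \<and> y (i + 1) \<le> x i)"

type_synonym pattern = "nat \<Rightarrow> nat \<Rightarrow> nat"

definition patterns :: "nat \<Rightarrow> pattern set" where
  "patterns n = {Z.
     (\<forall>k. k \<notin> {1..2 * n} \<longrightarrow> Z k = (\<lambda>_. 0)) \<and>
     (\<forall>l\<in>{1..n}. Z (2 * l - 1) \<in> partitions l \<and> Z (2 * l) \<in> partitions l) \<and>
     (\<forall>k\<in>{1..<2 * n}. Z k \<preceq> Z (k + 1))}"

definition qpoch :: "real \<Rightarrow> nat \<Rightarrow> real" where
  "qpoch q k = (\<Prod>j=1..k. 1 - q ^ j)"

text \<open>Below, \<open>k \<le> N\<close> holds in every use on a pattern, because of the interlacing.\<close>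

definition qbinomial :: "real \<Rightarrow> nat \<Rightarrow> nat \<Rightarrow> real" where
  "qbinomial q N k = qpoch q N / (qpoch q k * qpoch q (N - k))"

definition pattern_monomial :: "nat \<Rightarrow> (nat \<Rightarrow> real) \<Rightarrow> pattern \<Rightarrow> real" where
  "pattern_monomial n a Z = (\<Prod>i=1..n. a i powi
     (2 * int (psize i (Z (2 * i - 1))) - int (psize i (Z (2 * i)))
        - int (psize (i - 1) (Z (2 * i - 2)))))"

definition kappa :: "nat \<Rightarrow> real \<Rightarrow> pattern \<Rightarrow> real" where
  "kappa n q Z = (\<Prod>k=1..n.
     (\<Prod>i=1..k - 1.
        qbinomial q (Z (2 * k - 1) i - Z (2 * k - 1) (i + 1)) (Z (2 * k - 1) i - Z (2 * k - 2) i) *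
        qbinomial q (Z (2 * k) i - Z (2 * k) (i + 1)) (Z (2 * k) i - Z (2 * k - 1) i)) *
     qbinomial q (Z (2 * k) k) (Z (2 * k) k - Z (2 * k - 1) k))"

definition kernel_K :: "nat \<Rightarrow> real \<Rightarrow> (nat \<Rightarrow> real) \<Rightarrow> (nat \<Rightarrow> nat) \<Rightarrow> pattern \<Rightarrow> real" where
  "kernel_K n q a lam Z = pattern_monomial n a Z * kappa n q Z * of_bool (Z (2 * n) = lam)"

definition u_plus :: "real \<Rightarrow> nat \<Rightarrow> (nat \<Rightarrow> nat) \<Rightarrow> real" where
  "u_plus q i lam = (if i = 1 then 1 else 1 - q ^ (lam (i - 1) - lam i))"

definition u_minus :: "nat \<Rightarrow> real \<Rightarrow> nat \<Rightarrow> (nat \<Rightarrow> nat) \<Rightarrow> real" where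
  "u_minus n q i lam = (if i = n then 1 - q ^ lam n else 1 - q ^ (lam i - lam (i + 1)))"

definition add_unit :: "nat \<Rightarrow> (nat \<Rightarrow> nat) \<Rightarrow> (nat \<Rightarrow> nat)" where
  "add_unit i x = x(i := x i + 1)"

text \<open>
  At most one of the conditions in the following sum holds, so it is a case distinction; the
  condition \<open>lam = add_unit i mu\<close> expresses that \<open>mu\<close> is \<open>lam\<close> minus the \<open>i\<close>-th unit vector.
\<close>

definition kernel_L :: "nat \<Rightarrow> real \<Rightarrow> (nat \<Rightarrow> nat) \<Rightarrow> (nat \<Rightarrow> nat) \<Rightarrow> real" where
  "kernel_L n q lam mu = (\<Sum>i=1..n.
     (if mu = add_unit i lam then u_plus q i lam else 0) +
     (if lam = add_unit i mu then u_minus n q i lam else 0))"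

text \<open>\<open>q\<close> to the power \<open>x i - m\<close>, under the convention that coordinate 0 of \<open>x\<close> is infinite\<close>

definition qpow_gap :: "real \<Rightarrow> (nat \<Rightarrow> nat) \<Rightarrow> nat \<Rightarrow> nat \<Rightarrow> real" where
  "qpow_gap q x i m = (if i = 0 then 0 else q ^ (x i - m))"

definition r_prob :: "real \<Rightarrow> nat \<Rightarrow> (nat \<Rightarrow> nat) \<Rightarrow> (nat \<Rightarrow> nat) \<Rightarrow> real" where
  "r_prob q i y x =
     q ^ (y i - x i) * ((1 - qpow_gap q x (i - 1) (y i)) / (1 - qpow_gap q x (i - 1) (x i)))"

definition l_prob :: "real \<Rightarrow> nat \<Rightarrow> (nat \<Rightarrow> nat) \<Rightarrow> (nat \<Rightarrow> nat) \<Rightarrow> real" where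
  "l_prob q i y x =
     q ^ (x i - y (i + 1)) * ((1 - q ^ (y (i + 1) - x (i + 1))) / (1 - q ^ (x i - x (i + 1))))"

definition move_right :: "nat \<Rightarrow> nat \<Rightarrow> pattern \<Rightarrow> pattern" where
  "move_right k i Z = Z(k := (Z k)(i := Z k i + 1))"

definition move_left :: "nat \<Rightarrow> nat \<Rightarrow> pattern \<Rightarrow> pattern" where
  "move_left k i Z = Z(k := (Z k)(i := Z k i - 1))"

text \<open>
  The laws of the final configuration when particle \<open>i\<close> on level \<open>k\<close> performs a left jump, resp.
  attempts a right jump, in configuration \<open>Z\<close>. Started from a pattern, levels \<open>k\<close> and \<open>k + 1\<close> are
  still the original ones at that time, so all parameters of \<open>bernoulli_pmf\<close> lie in the unit
  interval. Forbidden moves (in particular a left jump of a particle at 0, where \<open>move_left\<close>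
  truncates, or vanishing denominators) are only reached with probability 0.
\<close>

function left_jump :: "nat \<Rightarrow> real \<Rightarrow> nat \<Rightarrow> nat \<Rightarrow> pattern \<Rightarrow> pattern pmf" where
  "left_jump n q k i Z =
     (if k < 2 * n then
        bind_pmf (bernoulli_pmf (l_prob q i (Z (k + 1)) (Z k)))
          (\<lambda>b. if b then left_jump n q (k + 1) (i + 1) (move_left k i Z)
                else left_jump n q (k + 1) i (move_left k i Z))
      else return_pmf (move_left k i Z))"
  by pat_completeness auto
termination
  by (relation "Wellfounded.measure (\<lambda>(n, q, k, i, Z). 2 * n - k)") auto

function right_jump :: "nat \<Rightarrow> real \<Rightarrow> nat \<Rightarrow> nat \<Rightarrow> pattern \<Rightarrow> pattern pmf" where
  "right_jump n q k i Z =
     (if k < 2 * n then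
        bind_pmf (bernoulli_pmf (r_prob q i (Z (k + 1)) (Z k)))
          (\<lambda>b. if odd k \<and> i = (k + 1) div 2
                then if b then right_jump n q (k + 1) i (move_right k i Z)
                     else left_jump n q (k + 1) i Z
                else if b then right_jump n q (k + 1) i (move_right k i Z)
                     else right_jump n q (k + 1) (i + 1) (move_right k i Z))
      else return_pmf (move_right k i Z))"
  by pat_completeness auto
termination
  by (relation "Wellfounded.measure (\<lambda>(n, q, k, i, Z). 2 * n - k)") auto

text \<open>The equations are unconditional, hence would make the simplifier loop.\<close>

declare left_jump.simps [simp del] right_jump.simps [simp del]

datatype letter = Plain nat | Barred nat

definition letters :: "nat \<Rightarrow> letter set" where
  "letters n = Plain ` {1..n} \<union> Barred ` {1..n}"

fun letter_order :: "letter \<Rightarrow> nat" where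
  "letter_order (Plain l) = 2 * l - 1"
| "letter_order (Barred l) = 2 * l"

fun letter_weight :: "(nat \<Rightarrow> real) \<Rightarrow> letter \<Rightarrow> real" where
  "letter_weight a (Plain l) = a l"
| "letter_weight a (Barred l) = inverse (a l)"

definition q_insertion :: "nat \<Rightarrow> real \<Rightarrow> letter \<Rightarrow> pattern \<Rightarrow> pattern pmf" where
  "q_insertion n q c Z = right_jump n q (letter_order c) 1 Z"

definition kernel_M :: "nat \<Rightarrow> real \<Rightarrow> (nat \<Rightarrow> real) \<Rightarrow> pattern \<Rightarrow> pattern \<Rightarrow> real" where
  "kernel_M n q a Z Z' = (\<Sum>c\<in>letters n. letter_weight a c * pmf (q_insertion n q c Z) Z')"

end

theory Submission
  imports Defs
begin

text \<open>
  The insertion is processed one level at a time. At level \<open>k\<close> the randomness still to come depends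
  only on the levels \<open>\<ge> k\<close> of the old pattern and on the pending jump there, while the levels
  \<open>< k\<close> have reached their final values. Summing the old values of the lower levels out against
  \<open>K\<close>, the weight of a pending jump of particle \<open>i\<close> at \<open>x\<close> turns out to be explicit: with \<open>z\<close> the
  final level \<open>k - 1\<close> it is, up to factors carried by other levels, \<open>u_plus\<close> or \<open>u_minus\<close> at \<open>x\<close>
  times the branching weight of \<open>x \<plusminus> e_i\<close> over \<open>z\<close>. Passing from level \<open>k\<close> to level \<open>k + 1\<close>
  preserves this form by the two q-Pascal identities. The only exception is the last particle of an
  odd level: its left jumps are too rare by a term that is compensated exactly by the pulls due to
  suppressed right jumps. At level \<open>2 n\<close> the weights are the entries of \<open>L\<close>.
\<close>

section \<open>Branching weights and the weights of pending jumps\<close>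

text \<open>Setting this to \<open>0\<close> off the interlacing range makes the shift relations below unconditional.\<close>

definition qbin_gap :: "real \<Rightarrow> nat \<Rightarrow> nat \<Rightarrow> nat \<Rightarrow> real" where
  "qbin_gap q A c B = (if B \<le> c \<and> c \<le> A then qbinomial q (A - B) (A - c) else 0)"

text \<open>
  One formula serves both parities: for \<open>m\<close> particles on the lower level, the upper level has \<open>m + 1\<close>
  particles if it is odd, and \<open>m\<close> particles together with \<open>y (m + 1) = 0\<close> if it is even.
\<close>

definition branch :: "real \<Rightarrow> real \<Rightarrow> nat \<Rightarrow> (nat \<Rightarrow> nat) \<Rightarrow> (nat \<Rightarrow> nat) \<Rightarrow> real" where
  "branch q b m y x = b powi (int (psize (Suc m) y) - int (psize m x)) *
     (\<Prod>i=1..m. qbin_gap q (y i) (x i) (y (Suc i)))"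

lemma qpoch_0 [simp]: "qpoch q 0 = 1"
  by (simp add: qpoch_def)

lemma qpoch_Suc: "qpoch q (Suc k) = qpoch q k * (1 - q ^ Suc k)"
  by (simp add: qpoch_def)

lemma psize_upd:
  assumes "i \<in> {1..m}"
  shows "int (psize m (x(i := v))) = int (psize m x) - int (x i) + int v"
proof -
  have "psize m (x(i := v)) = v + (\<Sum>j\<in>{1..m} - {i}. x j)"
    using assms by (simp add: psize_def sum.remove[of _ i])
  moreover have "psize m x = x i + (\<Sum>j\<in>{1..m} - {i}. x j)"
    using assms by (simp add: psize_def sum.remove[of _ i])
  ultimately show ?thesis by simp
qed

lemma powi_up_down:
  fixes b :: real
  assumes "b \<noteq> 0"
  shows "b powi (e + 1) = b * b powi e" "b powi (e - 1) = inverse b * b powi e"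
  using assms by (simp_all add: power_int_add power_int_diff field_simps)

definition right_weight :: "real \<Rightarrow> real \<Rightarrow> nat \<Rightarrow> (nat \<Rightarrow> nat) \<Rightarrow> (nat \<Rightarrow> nat) \<Rightarrow> nat \<Rightarrow> real" where
  "right_weight q b k z x i = u_plus q i x * branch q b (k div 2) (add_unit i x) z"

text \<open>The subtracted term is the deficit of left jumps of the last particle on an odd level.\<close>

definition left_weight :: "real \<Rightarrow> real \<Rightarrow> nat \<Rightarrow> (nat \<Rightarrow> nat) \<Rightarrow> (nat \<Rightarrow> nat) \<Rightarrow> nat \<Rightarrow> real" where
  "left_weight q b k z x i = (1 - q ^ (x i - x (Suc i))) *
     (branch q b (k div 2) (x(i := x i - 1)) z -
      (if odd k \<and> i = (k + 1) div 2 then inverse b * branch q b (k div 2) x z else 0))"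

lemma partitions_outside: "x \<in> partitions m \<Longrightarrow> i \<notin> {1..m} \<Longrightarrow> x i = 0"
  by (auto simp: partitions_def)

lemma partitions_mono: "x \<in> partitions m \<Longrightarrow> 1 \<le> i \<Longrightarrow> x (Suc i) \<le> x i"
  by (cases "i < m") (auto simp: partitions_def)

lemma sub_add_unit: "(add_unit i x)(i := add_unit i x i - 1) = x"
  by (simp add: add_unit_def)

lemma add_unit_sub: "x i \<noteq> 0 \<Longrightarrow> add_unit i (x(i := x i - 1)) = x"
  by (auto simp: add_unit_def)

text \<open>Regrouping by the receiving particle: \<open>i\<close> gets \<open>A i\<close> from the
  particle of the same index below and \<open>C (i - 1)\<close> from its predecessor; particle 1 has
  no predecessor and gets the external source \<open>c\<close>.\<close>

lemma sum_shift_coeffs: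
  fixes A C R :: "nat \<Rightarrow> real"
  shows "(\<Sum>i=1..m. A i * R i + C i * R (Suc i)) + c * R 1 =
    (\<Sum>i=1..Suc m. ((if i \<le> m then A i else 0) + (if i = 1 then c else C (i - 1))) * R i)"
proof -
  have "(\<Sum>i=1..Suc m. (if i = 1 then c else C (i - 1)) * R i) = c * R 1 + (\<Sum>i=1..m. C i * R (Suc i))"
  proof (induction m)
    case (Suc m)
    then show ?case by (simp add: algebra_simps)
  qed simp
  moreover have "(\<Sum>i=1..Suc m. (if i \<le> m then A i else 0) * R i) = (\<Sum>i=1..m. A i * R i)"
    by simp
  ultimately show ?thesis
    by (simp add: distrib_right sum.distrib del: sum.cl_ivl_Suc)
qed

text \<open>
  The weight reaching the final value \<open>x\<close> of level \<open>k\<close> below the old level \<open>y\<close> through jumps of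
  particle \<open>i\<close>, where \<open>R j\<close> and \<open>S j\<close> stand for the continuation with a right, resp. left, jump of
  particle \<open>j\<close> on level \<open>k + 1\<close>.
\<close>

definition right_flow ::
  "real \<Rightarrow> real \<Rightarrow> real \<Rightarrow> nat \<Rightarrow> (nat \<Rightarrow> nat) \<Rightarrow> (nat \<Rightarrow> nat) \<Rightarrow> (nat \<Rightarrow> nat) \<Rightarrow>
    (nat \<Rightarrow> real) \<Rightarrow> (nat \<Rightarrow> real) \<Rightarrow> nat \<Rightarrow> real" where
  "right_flow q b bk k z y x R S i =
    (if x i = 0 then 0
     else branch q b ((k + 1) div 2) y (x(i := x i - 1)) * right_weight q bk k z (x(i := x i - 1)) i *
       (r_prob q i y (x(i := x i - 1)) * R i +
        (if odd k \<and> i = (k + 1) div 2 then 0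
         else (1 - r_prob q i y (x(i := x i - 1))) * R (Suc i)))) +
    (if odd k \<and> i = (k + 1) div 2
     then branch q b ((k + 1) div 2) y x * right_weight q bk k z x i * ((1 - r_prob q i y x) * S i) else 0)"

definition left_flow ::
  "real \<Rightarrow> real \<Rightarrow> real \<Rightarrow> nat \<Rightarrow> (nat \<Rightarrow> nat) \<Rightarrow> (nat \<Rightarrow> nat) \<Rightarrow> (nat \<Rightarrow> nat) \<Rightarrow>
    (nat \<Rightarrow> real) \<Rightarrow> nat \<Rightarrow> real" where
  "left_flow q b bk k z y x S i =
    branch q b ((k + 1) div 2) y (add_unit i x) * left_weight q bk k z (add_unit i x) i *
      (l_prob q i y (add_unit i x) * S (Suc i) + (1 - l_prob q i y (add_unit i x)) * S i)"

section \<open>Shift and Pascal relations for q-binomials\<close>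

context
  fixes q :: real
  assumes q0: "0 < q" and q1: "q < 1"
begin

lemma one_minus_pow_neq: "k \<noteq> 0 \<Longrightarrow> 1 - q ^ k \<noteq> 0"
  using q0 q1 power_less_one_iff[of q k] by simp

lemma qpoch_neq_0: "qpoch q k \<noteq> 0"
  by (induction k) (use one_minus_pow_neq in \<open>auto simp: qpoch_Suc simp del: power_Suc\<close>)

lemma qbin_gap_add: "qbin_gap q (B + s + t) (B + s) B = qpoch q (s + t) / (qpoch q t * qpoch q s)"
  by (simp add: qbin_gap_def qbinomial_def)

text \<open>Both sides are the same quotient of q-Pochhammer symbols. Off the interlacing range each
  side vanishes, either by definition of \<open>qbin_gap\<close> or because truncated subtraction
  produces \<open>1 - q ^ 0\<close>. The relations for the two ends \<open>A\<close> and
  \<open>B\<close> work alike.\<close>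

lemma qbin_gap_mid:
  "qbin_gap q A (Suc c) B * (1 - q ^ (Suc c - B)) = qbin_gap q A c B * (1 - q ^ (A - c))"
proof (cases "B \<le> c \<and> Suc c \<le> A")
  case True
  then obtain s t where st: "c = B + s" "A = B + s + Suc t"
    by (metis le_Suc_ex add_Suc_right add_Suc)
  have l: "qbin_gap q A (Suc c) B = qpoch q (Suc s + t) / (qpoch q t * qpoch q (Suc s))"
    using qbin_gap_add[of B "Suc s" t] st by simp
  have r: "qbin_gap q A c B = qpoch q (s + Suc t) / (qpoch q (Suc t) * qpoch q s)"
    using qbin_gap_add[of B s "Suc t"] st by simp
  show ?thesis
    unfolding l r
    using st qpoch_neq_0 one_minus_pow_neq[of "Suc s"] one_minus_pow_neq[of "Suc t"]
    by (simp add: qpoch_Suc divide_simps del: power_Suc)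
next
  case False
  then show ?thesis by (auto simp: qbin_gap_def not_less_eq_eq le_Suc_eq)
qed

lemma qbin_gap_upper:
  "qbin_gap q (Suc A) c B * (1 - q ^ (Suc A - c)) = qbin_gap q A c B * (1 - q ^ (Suc A - B))"
proof (cases "B \<le> c \<and> c \<le> A")
  case True
  then obtain s t where st: "c = B + s" "A = B + s + t"
    by (metis le_Suc_ex)
  have l: "qbin_gap q (Suc A) c B = qpoch q (Suc (s + t)) / (qpoch q (Suc t) * qpoch q s)"
    using qbin_gap_add[of B s "Suc t"] st by simp
  have r: "qbin_gap q A c B = qpoch q (s + t) / (qpoch q t * qpoch q s)"
    using qbin_gap_add[of B s t] st by simp
  show ?thesis
    unfolding l r
    using st qpoch_neq_0 one_minus_pow_neq[of "Suc t"]
    by (simp add: qpoch_Suc divide_simps Suc_diff_le del: power_Suc)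
next
  case False
  then show ?thesis by (auto simp: qbin_gap_def le_Suc_eq)
qed

lemma qbin_gap_lower:
  "qbin_gap q A c (Suc B) * (1 - q ^ (A - B)) = qbin_gap q A c B * (1 - q ^ (c - B))"
proof (cases "Suc B \<le> c \<and> c \<le> A")
  case True
  then obtain s t where st: "c = Suc B + s" "A = Suc B + s + t"
    by (metis le_Suc_ex)
  have l: "qbin_gap q A c B = qpoch q (Suc (s + t)) / (qpoch q t * qpoch q (Suc s))"
    using qbin_gap_add[of B "Suc s" t] st by simp
  have r: "qbin_gap q A c (Suc B) = qpoch q (s + t) / (qpoch q t * qpoch q s)"
    using qbin_gap_add[of "Suc B" s t] st by simp
  show ?thesis
    unfolding l r
    using st qpoch_neq_0 one_minus_pow_neq[of "Suc s"]
    by (simp add: qpoch_Suc divide_simps Suc_diff_le del: power_Suc)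
next
  case False
  then show ?thesis by (auto simp: qbin_gap_def not_less_eq_eq le_Suc_eq)
qed

text \<open>With \<open>u = q ^ (Suc B - d)\<close> and \<open>v = q ^ (d - C)\<close>, the shift
  relations combine through \<open>1 - u * v = (1 - u) + u * (1 - v)\<close>. The edges
  \<open>d = C\<close> and \<open>d = Suc B\<close> are checked directly.\<close>

lemma qbin_gap_pascal_upper:
  assumes "C \<le> B"
  shows "qbin_gap q (Suc B) d C =
    qbin_gap q B d C + (if d = 0 then 0 else q ^ (B - (d - 1)) * qbin_gap q B (d - 1) C)"
proof (cases "C \<le> d \<and> d \<le> B")
  case True
  show ?thesis
  proof (cases "C < d")
    case True': True
    then have E1: "qbin_gap q B d C * (1 - q ^ (d - C)) = qbin_gap q B (d - 1) C * (1 - q ^ (B - (d - 1)))"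
      using qbin_gap_mid[of B "d - 1" C] by simp
    have E2: "qbin_gap q (Suc B) d C * (1 - q ^ (Suc B - d)) = qbin_gap q B d C * (1 - q ^ (Suc B - C))"
      by (rule qbin_gap_upper)
    have e: "B - (d - 1) = Suc B - d" "Suc B - C = (Suc B - d) + (d - C)"
      using True True' by auto
    define u v where "u = q ^ (Suc B - d)" and "v = q ^ (d - C)"
    have u: "1 - u \<noteq> 0"
      using True one_minus_pow_neq[of "Suc B - d"] by (simp add: u_def Suc_diff_le)
    have "qbin_gap q (Suc B) d C * (1 - u) = qbin_gap q B d C * (1 - u * v)"
      using E2 unfolding e(2) power_add u_def v_def .
    also have "\<dots> = qbin_gap q B d C * (1 - u) + u * (qbin_gap q B d C * (1 - v))"
      by (simp add: algebra_simps)
    also have "\<dots> = (qbin_gap q B d C + u * qbin_gap q B (d - 1) C) * (1 - u)"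
      using E1 unfolding e(1) u_def v_def by (simp add: algebra_simps)
    finally have "qbin_gap q (Suc B) d C = qbin_gap q B d C + u * qbin_gap q B (d - 1) C"
      using u by simp
    then show ?thesis using True' e(1) u_def by simp
  next
    case False
    then have "d = C" using True by simp
    then show ?thesis
      using True qpoch_neq_0 by (auto simp: qbin_gap_def qbinomial_def Suc_diff_le)
  qed
next
  case False
  then show ?thesis
    using assms qpoch_neq_0 by (cases "d = Suc B") (auto simp: qbin_gap_def qbinomial_def)
qed

text \<open>Mirror image for the lower end. The upper version will serve right jumps of an upper
  particle, this one left jumps.\<close>

lemma qbin_gap_pascal_lower:
  assumes "Suc B \<le> A"
  shows "qbin_gap q A c B = qbin_gap q A c (Suc B) + q ^ (c - B) * qbin_gap q A (Suc c) (Suc B)"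
proof (cases "B < c \<and> c \<le> A")
  case True
  have E1: "qbin_gap q A (Suc c) (Suc B) * (1 - q ^ (c - B)) = qbin_gap q A c (Suc B) * (1 - q ^ (A - c))"
    using qbin_gap_mid[of A c "Suc B"] by simp
  have E2: "qbin_gap q A c (Suc B) * (1 - q ^ (A - B)) = qbin_gap q A c B * (1 - q ^ (c - B))"
    by (rule qbin_gap_lower)
  have e: "A - B = (c - B) + (A - c)" using True by auto
  define u v where "u = q ^ (c - B)" and "v = q ^ (A - c)"
  have u: "1 - u \<noteq> 0"
    using True one_minus_pow_neq[of "c - B"] by (simp add: u_def)
  have "qbin_gap q A c B * (1 - u) = qbin_gap q A c (Suc B) * (1 - u * v)"
    using E2 unfolding e power_add u_def v_def by simp
  also have "\<dots> = qbin_gap q A c (Suc B) * (1 - u) + u * (qbin_gap q A c (Suc B) * (1 - v))"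
    by (simp add: algebra_simps)
  also have "\<dots> = (qbin_gap q A c (Suc B) + u * qbin_gap q A (Suc c) (Suc B)) * (1 - u)"
    using E1[folded u_def v_def] by (simp add: distrib_right mult.assoc)
  finally show ?thesis using u u_def by simp
next
  case False
  then show ?thesis
    using assms qpoch_neq_0 by (cases "c = B") (auto simp: qbin_gap_def qbinomial_def)
qed

section \<open>Branching weights under unit moves\<close>

text \<open>\<open>x i\<close> occurs only in the \<open>i\<close>-th factor and in the power of
  \<open>b\<close>, so \<open>qbin_gap_mid\<close> applies. This trades the weight before a jump of
  a lower particle for the weight after it.\<close>

lemma branch_lower_shift:
  assumes "i \<in> {1..m}" "b \<noteq> 0"
  shows "branch q b m y x * (1 - q ^ (y i - x i)) =
    b * branch q b m y (add_unit i x) * (1 - q ^ (Suc (x i) - y (Suc i)))"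
proof -
  define R where "R = (\<Prod>j\<in>{1..m} - {i}. qbin_gap q (y j) (x j) (y (Suc j)))"
  define e where "e = int (psize (Suc m) y) - int (psize m x)"
  have 1: "branch q b m y x = b powi e * (qbin_gap q (y i) (x i) (y (Suc i)) * R)"
    using assms by (simp add: branch_def R_def e_def prod.remove[of _ i])
  have 2: "branch q b m y (add_unit i x) = b powi (e - 1) * (qbin_gap q (y i) (Suc (x i)) (y (Suc i)) * R)"
    using assms by (simp add: branch_def R_def e_def prod.remove[of _ i] add_unit_def psize_upd
        algebra_simps)
  have 3: "b * b powi (e - 1) = b powi e"
    using assms by (simp add: power_int_diff)
  have "b * branch q b m y (add_unit i x) * (1 - q ^ (Suc (x i) - y (Suc i))) =
     (b * b powi (e - 1)) * R * (qbin_gap q (y i) (Suc (x i)) (y (Suc i)) * (1 - q ^ (Suc (x i) - y (Suc i))))"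
    unfolding 2 by (simp add: mult_ac)
  also have "\<dots> = branch q b m y x * (1 - q ^ (y i - x i))"
    unfolding 1 3 qbin_gap_mid by (simp add: mult_ac)
  finally show ?thesis ..
qed

text \<open>Isolates the factors \<open>i - 1\<close> and \<open>i\<close>, the only ones containing
  \<open>y i\<close>. The first is missing for \<open>i = 1\<close>, the second for
  \<open>i = Suc m\<close>.\<close>

lemma branch_split:
  assumes "i \<in> {1..Suc m}"
  shows "branch q b m y x = b powi (int (psize (Suc m) y) - int (psize m x)) *
    (if i = 1 then 1 else qbin_gap q (y (i - 1)) (x (i - 1)) (y i)) *
    (if m < i then 1 else qbin_gap q (y i) (x i) (y (Suc i))) *
    (\<Prod>j\<in>{1..m} - {i - 1, i}. qbin_gap q (y j) (x j) (y (Suc j)))"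
proof -
  let ?f = "\<lambda>j. qbin_gap q (y j) (x j) (y (Suc j))"
  have "(\<Prod>j\<in>{1..m}. ?f j) = (\<Prod>j\<in>{1..m} \<inter> {i - 1, i}. ?f j) * (\<Prod>j\<in>{1..m} - {i - 1, i}. ?f j)"
    by (rule prod.Int_Diff) auto
  moreover have "(\<Prod>j\<in>{1..m} \<inter> {i - 1, i}. ?f j) =
      (if i = 1 then 1 else ?f (i - 1)) * (if m < i then 1 else ?f i)"
  proof -
    consider "i = 1" "m < i" | "i = 1" "i \<le> m" | "i \<noteq> 1" "m < i" | "i \<noteq> 1" "i \<le> m"
      by linarith
    then show ?thesis
    proof cases
      case 1
      then have "{1..m} \<inter> {i - 1, i} = {}" by auto
      then show ?thesis using 1 by simp
    next
      case 2
      then have "{1..m} \<inter> {i - 1, i} = {i}" by auto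
      then show ?thesis using 2 by simp
    next
      case 3
      then have "{1..m} \<inter> {i - 1, i} = {i - 1}" using assms by auto
      then show ?thesis using 3 by simp
    next
      case 4
      then have "{1..m} \<inter> {i - 1, i} = {i - 1, i}" "i - 1 \<noteq> i" using assms by auto
      then show ?thesis using 4 by simp
    qed
  qed
  moreover have "i \<noteq> 1 \<Longrightarrow> Suc (i - 1) = i" using assms by auto
  ultimately show ?thesis by (simp add: branch_def)
qed

text \<open>Raising \<open>y i\<close> moves the lower end of factor \<open>i - 1\<close>, where
  \<open>qbin_gap_lower\<close> absorbs \<open>u_plus\<close>, and the upper end of factor
  \<open>i\<close>, which q-Pascal splits. The two terms are the sources of a right jump of upper
  particle \<open>i\<close>: a pull by particle \<open>i - 1\<close> (for \<open>i = 1\<close> the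
  fresh letter), and a push by particle \<open>i\<close>, whose old value was
  \<open>x i - 1\<close>.\<close>

lemma branch_add_upper:
  assumes i: "i \<in> {1..Suc m}" and b: "b \<noteq> 0" and y: "y (Suc i) \<le> y i"
  shows "u_plus q i y * branch q b m (add_unit i y) x = (1 - qpow_gap q x (i - 1) (y i)) *
    (b * branch q b m y x +
     (if x i = 0 \<or> m < i then 0
      else q ^ (y i - (x i - 1)) * branch q b m y (x(i := x i - 1))))"
proof -
  define R where "R = (\<Prod>j\<in>{1..m} - {i - 1, i}. qbin_gap q (y j) (x j) (y (Suc j)))"
  define P where "P = b powi (int (psize (Suc m) y) - int (psize m x))"
  define L where "L v = (if i = 1 then 1 else qbin_gap q (y (i - 1)) (x (i - 1)) v)" for v
  define U where "U v w = (if m < i then 1 else qbin_gap q v w (y (Suc i)))" for v w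
  have B0: "branch q b m y x = P * L (y i) * U (y i) (x i) * R"
    unfolding branch_split[OF i] P_def L_def U_def R_def by simp
  have B1: "branch q b m (add_unit i y) x = (b * P) * L (Suc (y i)) * U (Suc (y i)) (x i) * R"
  proof -
    have "(\<Prod>j\<in>{1..m} - {i - 1, i}. qbin_gap q (add_unit i y j) (x j) (add_unit i y (Suc j))) = R"
      unfolding R_def by (rule prod.cong) (auto simp: add_unit_def)
    moreover have "b powi (int (psize (Suc m) (add_unit i y)) - int (psize m x)) = b * P"
      unfolding P_def add_unit_def psize_upd[OF i] powi_up_down(1)[OF b, symmetric]
      by (simp add: algebra_simps)
    moreover have "add_unit i y (i - 1) = y (i - 1)"
      using i by (auto simp: add_unit_def)
    ultimately show ?thesis
      unfolding branch_split[OF i, of b "add_unit i y" x]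
      by (simp add: L_def U_def) (auto simp: add_unit_def)
  qed
  have B2: "branch q b m y (x(i := x i - 1)) = (b * P) * L (y i) * U (y i) (x i - 1) * R"
    if "i \<le> m" "x i \<noteq> 0"
  proof -
    have "(\<Prod>j\<in>{1..m} - {i - 1, i}. qbin_gap q (y j) ((x(i := x i - 1)) j) (y (Suc j))) = R"
      unfolding R_def by (rule prod.cong) auto
    moreover have "b powi (int (psize (Suc m) y) - int (psize m (x(i := x i - 1)))) = b * P"
      using i that unfolding P_def powi_up_down(1)[OF b, symmetric]
      by (simp add: psize_upd algebra_simps of_nat_diff)
    moreover have "(x(i := x i - 1)) (i - 1) = x (i - 1)"
      using i by auto
    ultimately show ?thesis
      unfolding branch_split[OF i, of b y "x(i := x i - 1)"]
      by (simp add: L_def U_def)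
  qed
  have uL: "u_plus q i y * L (Suc (y i)) = (1 - qpow_gap q x (i - 1) (y i)) * L (y i)"
  proof (cases "i = 1")
    case True
    then show ?thesis by (simp add: u_plus_def L_def qpow_gap_def)
  next
    case False
    then have "i - 1 \<noteq> 0" using i by auto
    then show ?thesis
      using False qbin_gap_lower[of "y (i - 1)" "x (i - 1)" "y i"]
      by (simp add: u_plus_def L_def qpow_gap_def mult.commute)
  qed
  have UU: "U (Suc (y i)) (x i) = U (y i) (x i) +
      (if x i = 0 \<or> m < i then 0 else q ^ (y i - (x i - 1)) * U (y i) (x i - 1))"
    using qbin_gap_pascal_upper[OF y, of "x i"] by (auto simp: U_def)
  have "u_plus q i y * branch q b m (add_unit i y) x =
      (u_plus q i y * L (Suc (y i))) * (b * P) * U (Suc (y i)) (x i) * R"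
    unfolding B1 by (simp add: mult_ac)
  also have "\<dots> = (1 - qpow_gap q x (i - 1) (y i)) *
     (b * branch q b m y x +
     (if x i = 0 \<or> m < i then 0
      else q ^ (y i - (x i - 1)) * branch q b m y (x(i := x i - 1))))"
    unfolding uL UU using B2 by (simp add: B0 algebra_simps)
  finally show ?thesis .
qed

text \<open>Lowering \<open>y i\<close> shifts the upper end of factor \<open>i\<close>, while
  q-Pascal splits factor \<open>i - 1\<close>. The summands are the left jumps handed on by particle
  \<open>i\<close> and by particle \<open>i - 1\<close>.\<close>

lemma branch_sub_upper:
  assumes i: "i \<in> {1..Suc m}" and b: "b \<noteq> 0" and y: "i \<noteq> 1 \<Longrightarrow> y i \<le> y (i - 1)"
    and last: "x (Suc m) = 0" "y (Suc (Suc m)) = 0"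
  shows "(1 - q ^ (y i - y (Suc i))) * branch q b m (y(i := y i - 1)) x = (1 - q ^ (y i - x i)) *
    (inverse b * branch q b m y x +
     (if i = 1 then 0
      else q ^ (Suc (x (i - 1)) - y i) * branch q b m y (add_unit (i - 1) x)))"
proof (cases "y i = 0")
  case True
  then show ?thesis by simp
next
  case False
  define R where "R = (\<Prod>j\<in>{1..m} - {i - 1, i}. qbin_gap q (y j) (x j) (y (Suc j)))"
  define P where "P = b powi (int (psize (Suc m) y) - int (psize m x))"
  define L where "L v w = (if i = 1 then 1 else qbin_gap q (y (i - 1)) w v)" for v w
  define U where "U v = (if m < i then 1 else qbin_gap q v (x i) (y (Suc i)))" for v
  have B0: "branch q b m y x = P * L (y i) (x (i - 1)) * U (y i) * R"
    unfolding branch_split[OF i] P_def L_def U_def R_def by simp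
  have B1: "branch q b m (y(i := y i - 1)) x =
      (inverse b * P) * L (y i - 1) (x (i - 1)) * U (y i - 1) * R"
  proof -
    have "(\<Prod>j\<in>{1..m} - {i - 1, i}.
        qbin_gap q ((y(i := y i - 1)) j) (x j) ((y(i := y i - 1)) (Suc j))) = R"
      unfolding R_def by (rule prod.cong) auto
    moreover have "b powi (int (psize (Suc m) (y(i := y i - 1))) - int (psize m x)) = inverse b * P"
      using False unfolding P_def psize_upd[OF i] powi_up_down(2)[OF b, symmetric]
      by (simp add: of_nat_diff algebra_simps)
    moreover have "(y(i := y i - 1)) (i - 1) = y (i - 1)"
      using i by auto
    ultimately show ?thesis
      unfolding branch_split[OF i, of b "y(i := y i - 1)" x]
      by (simp add: L_def U_def)
  qed
  have B2: "branch q b m y (add_unit (i - 1) x) =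
      (inverse b * P) * L (y i) (Suc (x (i - 1))) * U (y i) * R" if "i \<noteq> 1"
  proof -
    have i1: "i - 1 \<in> {1..m}" using i that by auto
    have "(\<Prod>j\<in>{1..m} - {i - 1, i}. qbin_gap q (y j) (add_unit (i - 1) x j) (y (Suc j))) = R"
      unfolding R_def by (rule prod.cong) (auto simp: add_unit_def)
    moreover have "b powi (int (psize (Suc m) y) - int (psize m (add_unit (i - 1) x))) = inverse b * P"
      unfolding P_def add_unit_def psize_upd[OF i1] powi_up_down(2)[OF b, symmetric]
      by (simp add: algebra_simps)
    moreover have "add_unit (i - 1) x i = x i"
      using i by (auto simp: add_unit_def)
    ultimately show ?thesis
      unfolding branch_split[OF i, of b y "add_unit (i - 1) x"]
      by (simp add: L_def U_def) (auto simp: add_unit_def)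
  qed
  have uU: "(1 - q ^ (y i - y (Suc i))) * U (y i - 1) = (1 - q ^ (y i - x i)) * U (y i)"
  proof (cases "m < i")
    case True
    \<comment> \<open>Factor \<open>i\<close> is absent here, and both exponents reduce to
      \<open>y i\<close> since \<open>x i\<close> and \<open>y (Suc i)\<close> are 0.\<close>
    then have "i = Suc m" using i by auto
    then show ?thesis using last by (simp add: U_def)
  next
    case nm: False
    then show ?thesis
      using False qbin_gap_upper[of "y i - 1" "x i" "y (Suc i)"]
      by (simp add: U_def mult.commute)
  qed
  have LL: "L (y i - 1) (x (i - 1)) = L (y i) (x (i - 1)) +
      (if i = 1 then 0 else q ^ (Suc (x (i - 1)) - y i) * L (y i) (Suc (x (i - 1))))"
  proof (cases "i = 1")
    case True
    then show ?thesis by (simp add: L_def)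
  next
    case i1: False
    have "x (i - 1) - (y i - 1) = Suc (x (i - 1)) - y i" using False by auto
    then show ?thesis
      using i1 False qbin_gap_pascal_lower[of "y i - 1" "y (i - 1)" "x (i - 1)"] y
      by (simp add: L_def)
  qed
  have "(1 - q ^ (y i - y (Suc i))) * branch q b m (y(i := y i - 1)) x =
      ((1 - q ^ (y i - y (Suc i))) * U (y i - 1)) * (inverse b * P) * L (y i - 1) (x (i - 1)) * R"
    unfolding B1 by (simp add: mult_ac)
  also have "\<dots> = (1 - q ^ (y i - x i)) * (inverse b * branch q b m y x +
     (if i = 1 then 0
      else q ^ (Suc (x (i - 1)) - y i) * branch q b m y (add_unit (i - 1) x)))"
    unfolding uU LL using B2 by (simp add: B0 algebra_simps)
  finally show ?thesis .
qed

section \<open>Interlacing and jump probabilities\<close>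

lemma branch_neq_0_interlaced:
  assumes "branch q b m y x \<noteq> 0" "i \<in> {1..m}"
  shows "x i \<le> y i" "y (Suc i) \<le> x i"
proof -
  have "qbin_gap q (y i) (x i) (y (Suc i)) \<noteq> 0"
    using assms by (auto simp: branch_def)
  then show "x i \<le> y i" "y (Suc i) \<le> x i"
    by (auto simp: qbin_gap_def split: if_splits)
qed

text \<open>\<open>u_plus\<close> is the denominator of \<open>r_prob\<close>, so the product clears
  it. If it vanishes, the hypotheses force \<open>y i = x i\<close> and the right-hand sides vanish
  too. The same mechanism works for \<open>l_prob\<close> below.\<close>

lemma u_plus_r_prob:
  assumes "i \<ge> 1" "x i \<le> y i" "i \<noteq> 1 \<Longrightarrow> y i \<le> x (i - 1)"
  shows "u_plus q i x * r_prob q i y x = q ^ (y i - x i) * (1 - qpow_gap q x (i - 1) (y i))"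
    and "u_plus q i x * (1 - r_prob q i y x) = 1 - q ^ (y i - x i)"
    and "0 \<le> r_prob q i y x" "r_prob q i y x \<le> 1"
proof -
  show 1: "u_plus q i x * r_prob q i y x = q ^ (y i - x i) * (1 - qpow_gap q x (i - 1) (y i))"
  proof (cases "i = 1")
    case True
    then show ?thesis by (simp add: u_plus_def r_prob_def qpow_gap_def)
  next
    case False
    then have "i - 1 \<noteq> 0" using assms by auto
    show ?thesis
    proof (cases "x (i - 1) = x i")
      case True
      then show ?thesis
        using assms False \<open>i - 1 \<noteq> 0\<close> by (simp add: u_plus_def r_prob_def qpow_gap_def)
    next
      case ne: False
      then have "x (i - 1) - x i \<noteq> 0" using assms False by auto
      from one_minus_pow_neq[OF this] show ?thesis
        using assms False \<open>i - 1 \<noteq> 0\<close> by (simp add: u_plus_def r_prob_def qpow_gap_def)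
    qed
  qed
  show "u_plus q i x * (1 - r_prob q i y x) = 1 - q ^ (y i - x i)"
  proof (cases "i = 1")
    case True
    then show ?thesis by (simp add: u_plus_def r_prob_def qpow_gap_def)
  next
    case False
    then have "i - 1 \<noteq> 0" "x (i - 1) - x i = (y i - x i) + (x (i - 1) - y i)"
      using assms by auto
    then have "u_plus q i x = 1 - q ^ (y i - x i) * q ^ (x (i - 1) - y i)"
      and "1 - qpow_gap q x (i - 1) (y i) = 1 - q ^ (x (i - 1) - y i)"
      using False by (simp_all add: u_plus_def qpow_gap_def power_add)
    then show ?thesis
      using 1 by (simp add: algebra_simps)
  qed
  have g: "0 \<le> qpow_gap q x (i - 1) (x i)" "qpow_gap q x (i - 1) (x i) \<le> qpow_gap q x (i - 1) (y i)"
     "qpow_gap q x (i - 1) (y i) \<le> 1"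
    using q0 q1 assms
    by (auto simp: qpow_gap_def intro!: power_decreasing power_le_one)
  then have f: "0 \<le> (1 - qpow_gap q x (i - 1) (y i)) / (1 - qpow_gap q x (i - 1) (x i))"
     "(1 - qpow_gap q x (i - 1) (y i)) / (1 - qpow_gap q x (i - 1) (x i)) \<le> 1"
    by (auto intro!: divide_nonneg_nonneg divide_le_eq_1[THEN iffD2])
  show "0 \<le> r_prob q i y x" "r_prob q i y x \<le> 1"
    unfolding r_prob_def using f q0 q1
    by (auto intro!: mult_nonneg_nonneg mult_le_one power_le_one simp del: times_divide_eq_right)
qed

lemma u_minus_l_prob:
  assumes "x (Suc i) \<le> y (Suc i)" "y (Suc i) \<le> x i"
  shows "(1 - q ^ (x i - x (Suc i))) * l_prob q i y x =
      q ^ (x i - y (Suc i)) * (1 - q ^ (y (Suc i) - x (Suc i)))"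
    and "(1 - q ^ (x i - x (Suc i))) * (1 - l_prob q i y x) = 1 - q ^ (x i - y (Suc i))"
    and "0 \<le> l_prob q i y x" "l_prob q i y x \<le> 1"
proof -
  show 1: "(1 - q ^ (x i - x (Suc i))) * l_prob q i y x =
      q ^ (x i - y (Suc i)) * (1 - q ^ (y (Suc i) - x (Suc i)))"
  proof (cases "x i = x (Suc i)")
    case True
    then show ?thesis using assms by (simp add: l_prob_def)
  next
    case False
    then have "x i - x (Suc i) \<noteq> 0" using assms by auto
    from one_minus_pow_neq[OF this] show ?thesis by (simp add: l_prob_def)
  qed
  have "x i - x (Suc i) = (x i - y (Suc i)) + (y (Suc i) - x (Suc i))"
    using assms by auto
  then have "q ^ (x i - x (Suc i)) = q ^ (x i - y (Suc i)) * q ^ (y (Suc i) - x (Suc i))"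
    by (simp only: power_add)
  then show "(1 - q ^ (x i - x (Suc i))) * (1 - l_prob q i y x) = 1 - q ^ (x i - y (Suc i))"
    using 1 by (simp add: algebra_simps)
  have g: "0 \<le> q ^ (x i - x (Suc i))" "q ^ (x i - x (Suc i)) \<le> q ^ (y (Suc i) - x (Suc i))"
     "q ^ (y (Suc i) - x (Suc i)) \<le> 1"
    using q0 q1 assms by (auto intro!: power_decreasing power_le_one)
  then have f: "0 \<le> (1 - q ^ (y (Suc i) - x (Suc i))) / (1 - q ^ (x i - x (Suc i)))"
     "(1 - q ^ (y (Suc i) - x (Suc i))) / (1 - q ^ (x i - x (Suc i))) \<le> 1"
    by (auto intro!: divide_nonneg_nonneg divide_le_eq_1[THEN iffD2])
  show "0 \<le> l_prob q i y x" "l_prob q i y x \<le> 1"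
    unfolding l_prob_def using f q0 q1
    by (auto intro!: mult_nonneg_nonneg mult_le_one power_le_one simp del: times_divide_eq_right)
qed


text \<open>\<open>x0\<close> is the old and \<open>x\<close> the final value of the lower level.
  The push term stays at \<open>x0\<close>, as in \<open>branch_add_upper\<close>; the pull term is
  rewritten at \<open>x\<close> by \<open>branch_lower_shift\<close>. Interlacing is not assumed:
  where the weight at \<open>x0\<close> vanishes, both sides are 0.\<close>

lemma step_right:
  assumes b: "b \<noteq> 0" and i: "i \<in> {1..m}" and xi: "x i \<noteq> 0"
  defines "x0 \<equiv> x(i := x i - 1)"
  shows "branch q b m y x0 * (u_plus q i x0 * r_prob q i y x0) =
      (1 - qpow_gap q x (i - 1) (y i)) * (q ^ (y i - (x i - 1)) * branch q b m y x0)"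
    and "branch q b m y x0 * (u_plus q i x0 * (1 - r_prob q i y x0)) =
      b * branch q b m y x * (1 - q ^ (x i - y (Suc i)))"
proof -
  have g: "qpow_gap q x0 (i - 1) (y i) = qpow_gap q x (i - 1) (y i)"
    using i by (auto simp: qpow_gap_def x0_def)
  have shift: "branch q b m y x0 * (1 - q ^ (y i - x0 i)) = b * branch q b m y x * (1 - q ^ (x i - y (Suc i)))"
    using branch_lower_shift[OF i b, of y x0] xi add_unit_sub[of x i, OF xi] by (simp add: x0_def)
  have p: "u_plus q i x0 * r_prob q i y x0 = q ^ (y i - x0 i) * (1 - qpow_gap q x0 (i - 1) (y i))"
      "u_plus q i x0 * (1 - r_prob q i y x0) = 1 - q ^ (y i - x0 i)"
    if nz: "branch q b m y x0 \<noteq> 0"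
  proof -
    have "i \<noteq> 1 \<Longrightarrow> i - 1 \<in> {1..m}" "i \<noteq> 1 \<Longrightarrow> Suc (i - 1) = i" using i by auto
    then have "x0 i \<le> y i" "i \<noteq> 1 \<Longrightarrow> y i \<le> x0 (i - 1)"
      using branch_neq_0_interlaced[OF nz, of i] branch_neq_0_interlaced[OF nz, of "i - 1"] i
      by auto
    with i show "u_plus q i x0 * r_prob q i y x0 = q ^ (y i - x0 i) * (1 - qpow_gap q x0 (i - 1) (y i))"
      "u_plus q i x0 * (1 - r_prob q i y x0) = 1 - q ^ (y i - x0 i)"
      using u_plus_r_prob(1,2)[of i x0 y] by auto
  qed
  show "branch q b m y x0 * (u_plus q i x0 * r_prob q i y x0) =
      (1 - qpow_gap q x (i - 1) (y i)) * (q ^ (y i - (x i - 1)) * branch q b m y x0)"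
  proof (cases "branch q b m y x0 = 0")
    case False
    show ?thesis unfolding p(1)[OF False] g by (simp add: x0_def)
  qed simp
  show "branch q b m y x0 * (u_plus q i x0 * (1 - r_prob q i y x0)) =
      b * branch q b m y x * (1 - q ^ (x i - y (Suc i)))"
    using p(2) shift by (cases "branch q b m y x0 = 0") auto
qed

text \<open>Counterpart for left jumps: the term for particle \<open>Suc i\<close> keeps the old
  weight, the term for \<open>i\<close> is shifted to \<open>x\<close>. For \<open>i = m\<close> the
  bound \<open>x0 (Suc i) \<le> y (Suc i)\<close> comes from \<open>x (Suc m) = 0\<close>.\<close>

lemma step_left:
  assumes b: "b \<noteq> 0" and i: "i \<in> {1..m}" and xm: "x (Suc m) = 0"
  defines "x0 \<equiv> add_unit i x"
  shows "branch q b m y x0 * ((1 - q ^ (x0 i - x0 (Suc i))) * l_prob q i y x0) =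
      (1 - q ^ (y (Suc i) - x (Suc i))) * (q ^ (Suc (x i) - y (Suc i)) * branch q b m y x0)"
    and "branch q b m y x0 * ((1 - q ^ (x0 i - x0 (Suc i))) * (1 - l_prob q i y x0)) =
      inverse b * branch q b m y x * (1 - q ^ (y i - x i))"
proof -
  have s: "x0 (Suc i) = x (Suc i)" "x0 i = Suc (x i)" by (auto simp: x0_def add_unit_def)
  have shift: "inverse b * branch q b m y x * (1 - q ^ (y i - x i)) =
      branch q b m y x0 * (1 - q ^ (Suc (x i) - y (Suc i)))"
    using branch_lower_shift[OF i b, of y x] b by (simp add: x0_def mult.assoc)
  have p: "(1 - q ^ (x0 i - x0 (Suc i))) * l_prob q i y x0 =
        q ^ (x0 i - y (Suc i)) * (1 - q ^ (y (Suc i) - x0 (Suc i)))"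
      "(1 - q ^ (x0 i - x0 (Suc i))) * (1 - l_prob q i y x0) = 1 - q ^ (x0 i - y (Suc i))"
    if nz: "branch q b m y x0 \<noteq> 0"
  proof -
    have "y (Suc i) \<le> x0 i" "x0 (Suc i) \<le> y (Suc i)"
      using branch_neq_0_interlaced[OF nz, of i] branch_neq_0_interlaced[OF nz, of "Suc i"] i s xm
      by (cases "i = m"; auto)+
    from u_minus_l_prob(1,2)[where x = x0 and y = y and i = i, OF this(2,1)]
    show "(1 - q ^ (x0 i - x0 (Suc i))) * l_prob q i y x0 =
        q ^ (x0 i - y (Suc i)) * (1 - q ^ (y (Suc i) - x0 (Suc i)))"
      "(1 - q ^ (x0 i - x0 (Suc i))) * (1 - l_prob q i y x0) = 1 - q ^ (x0 i - y (Suc i))" .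
  qed
  show "branch q b m y x0 * ((1 - q ^ (x0 i - x0 (Suc i))) * l_prob q i y x0) =
      (1 - q ^ (y (Suc i) - x (Suc i))) * (q ^ (Suc (x i) - y (Suc i)) * branch q b m y x0)"
  proof (cases "branch q b m y x0 = 0")
    case False
    show ?thesis unfolding p(1)[OF False] unfolding s by (simp only: mult_ac)
  qed simp
  show "branch q b m y x0 * ((1 - q ^ (x0 i - x0 (Suc i))) * (1 - l_prob q i y x0)) =
      inverse b * branch q b m y x * (1 - q ^ (y i - x i))"
    using p(2) shift s by (cases "branch q b m y x0 = 0") auto
qed

section \<open>Balance of the flows between adjacent levels\<close>

text \<open>As \<open>R\<close> and \<open>S\<close> are arbitrary, this compares coefficients:
  those on the right split by q-Pascal into contributions of two neighbouring lower particles. The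
  separate \<open>R 1\<close> term is the letter inserted at level \<open>k + 1\<close>; it replaces
  the pull that particle 1 lacks.\<close>

lemma flow_balance:
  fixes R S :: "nat \<Rightarrow> real"
  assumes b: "b \<noteq> 0" and bbk: "odd k \<Longrightarrow> bk * b = 1"
    and x: "x \<in> partitions ((k + 1) div 2)" and y: "y \<in> partitions ((k + 2) div 2)"
  shows "(\<Sum>i=1..(k + 1) div 2. right_flow q b bk k z y x R S i + left_flow q b bk k z y x S i) +
      branch q bk (k div 2) x z * (b * branch q b ((k + 1) div 2) y x) * R 1 =
    branch q bk (k div 2) x z *
      (\<Sum>i=1..(k + 2) div 2. right_weight q b (k + 1) x y i * R i + left_weight q b (k + 1) x y i * S i)"
proof -
  define m where "m = (k + 1) div 2"
  define V where "V = branch q bk (k div 2) x z"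
  \<comment> \<open>\<open>A\<close> and \<open>C\<close> are the coefficients of pushing particle
    \<open>i\<close> and pulling particle \<open>Suc i\<close> to the right, \<open>D\<close> and
    \<open>E\<close> those of handing a left jump to \<open>i\<close> and to
    \<open>Suc i\<close>.\<close>
  define A where "A i = (if x i = 0 then 0 else (1 - qpow_gap q x (i - 1) (y i)) *
      (q ^ (y i - (x i - 1)) * branch q b m y (x(i := x i - 1))))" for i
  define C where "C i = b * branch q b m y x * (1 - q ^ (x i - y (Suc i)))" for i
  define D where "D i = inverse b * branch q b m y x * (1 - q ^ (y i - x i))" for i
  define E where "E i = (1 - q ^ (y (Suc i) - x (Suc i))) *
      (q ^ (Suc (x i) - y (Suc i)) * branch q b m y (add_unit i x))" for i
  have xm: "x (Suc m) = 0"
    using partitions_outside[OF x] by (simp add: m_def)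
  have ym: "y (Suc (Suc m)) = 0" "odd k \<Longrightarrow> y (Suc m) = 0"
    using partitions_outside[OF y] by (auto simp: m_def elim!: oddE)
  have C0: "C i = 0" if "x i = 0" for i using that by (simp add: C_def)
  have Em: "odd k \<Longrightarrow> E m = 0" using ym by (simp add: E_def)

  have rw: "right_weight q b (k + 1) x y i = (if i \<le> m then A i else 0) +
      (if i = 1 then b * branch q b m y x else C (i - 1))" if i: "i \<in> {1..Suc m}" for i
  proof -
    have "y (Suc i) \<le> y i" using partitions_mono[OF y] i by simp
    from branch_add_upper[OF i b this, of x] show ?thesis
      unfolding right_weight_def m_def[symmetric]
      using i by (auto simp: A_def C_def qpow_gap_def algebra_simps)
  qed
  have lw: "left_weight q b (k + 1) x y i = (if i \<le> m then D i else 0) +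
      (if i = 1 then 0 else E (i - 1))" if i: "i \<in> {1..(k + 2) div 2}" for i
  proof -
    have i': "i \<in> {1..Suc m}" using i by (auto simp: m_def)
    have y1: "y i \<le> y (i - 1)" if "i \<noteq> 1"
      using partitions_mono[OF y, of "i - 1"] i that by (cases i) auto
    \<comment> \<open>For even \<open>k\<close> level \<open>k + 1\<close> has one extra particle,
      \<open>Suc m\<close>; for odd \<open>k\<close> the range of \<open>i\<close> ends at
      \<open>m\<close>.\<close>
    have im: "(odd (k + 1) \<and> i = (k + 1 + 1) div 2) = (\<not> i \<le> m)"
      using i unfolding m_def atLeastAtMost_iff by presburger
    have ux: "(1 - q ^ (y i - y (Suc i))) * branch q b m (y(i := y i - 1)) x = (1 - q ^ (y i - x i)) *
      (inverse b * branch q b m y x +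
       (if i = 1 then 0
        else q ^ (Suc (x (i - 1)) - y i) * branch q b m y (add_unit (i - 1) x)))"
      by (rule branch_sub_upper[OF i' b, where y = y and x = x, OF _ xm ym(1)]) (rule y1)
    have "left_weight q b (k + 1) x y i =
       (1 - q ^ (y i - y (Suc i))) * branch q b m (y(i := y i - 1)) x -
       (if i \<le> m then 0 else (1 - q ^ (y i - y (Suc i))) * (inverse b * branch q b m y x))"
      unfolding left_weight_def im m_def[symmetric]
      by (cases "i \<le> m") (simp_all add: right_diff_distrib)
    then have "left_weight q b (k + 1) x y i = (1 - q ^ (y i - x i)) * (inverse b * branch q b m y x +
       (if i = 1 then 0
        else q ^ (Suc (x (i - 1)) - y i) * branch q b m y (add_unit (i - 1) x))) -
       (if i \<le> m then 0 else (1 - q ^ (y i - y (Suc i))) * (inverse b * branch q b m y x))"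
      unfolding ux .
    note eq = this
    show ?thesis
    proof (cases "i \<le> m")
      case True
      then show ?thesis unfolding eq using i by (simp add: D_def E_def algebra_simps)
    next
      case False
      \<comment> \<open>No particle of index \<open>Suc m\<close> exists below, and the subtracted
        deficit removes exactly its would-be contribution; what remains comes from particle
        \<open>m\<close>, if any.\<close>
      then have "i = Suc m" using i' by simp
      then show ?thesis unfolding eq by (simp add: xm ym E_def algebra_simps)
    qed
  qed
  have rf: "right_flow q b bk k z y x R S i = V * (A i * R i + (if odd k \<and> i = m then 0 else C i * R (Suc i))) +
      (if odd k \<and> i = m then branch q b m y x * right_weight q bk k z x i * ((1 - r_prob q i y x) * S i) else 0)"
    if i: "i \<in> {1..m}" for i
  proof (cases "x i = 0")
    case True
    then show ?thesis by (simp add: right_flow_def m_def A_def C0)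
  next
    case False
    \<comment> \<open>The factor \<open>s\<close> will be 0 for the last particle of an odd level,
      which never pulls to the right, and 1 otherwise.\<close>
    have "branch q b m y (x(i := x i - 1)) * right_weight q bk k z (x(i := x i - 1)) i *
        (r_prob q i y (x(i := x i - 1)) * R i + s * ((1 - r_prob q i y (x(i := x i - 1))) * R (Suc i))) =
        V * ((branch q b m y (x(i := x i - 1)) * (u_plus q i (x(i := x i - 1)) * r_prob q i y (x(i := x i - 1)))) * R i +
          s * ((branch q b m y (x(i := x i - 1)) * (u_plus q i (x(i := x i - 1)) * (1 - r_prob q i y (x(i := x i - 1))))) * R (Suc i)))"
      for s
      unfolding right_weight_def add_unit_sub[of x i, OF False] V_def
      by (simp only: algebra_simps)
    then have *: "branch q b m y (x(i := x i - 1)) * right_weight q bk k z (x(i := x i - 1)) i *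
        (r_prob q i y (x(i := x i - 1)) * R i + s * ((1 - r_prob q i y (x(i := x i - 1))) * R (Suc i))) =
        V * (A i * R i + s * (C i * R (Suc i)))" for s
      unfolding step_right[where x = x and y = y and i = i and m = m, OF b i False] using False by (simp add: A_def C_def)
    show ?thesis
      using *[of 0] *[of 1] False unfolding right_flow_def m_def[symmetric] by auto
  qed
  have lf: "left_flow q b bk k z y x S i = V * (D i * S i + E i * S (Suc i)) -
      (if odd k \<and> i = m then inverse bk * branch q bk (k div 2) (add_unit i x) z * (D i * S i + E i * S (Suc i)) else 0)"
    if i: "i \<in> {1..m}" for i
  proof -
    define c where "c = V - (if odd k \<and> i = m then inverse bk * branch q bk (k div 2) (add_unit i x) z else 0)"
    have lwx: "left_weight q bk k z (add_unit i x) i =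
        (1 - q ^ (add_unit i x i - add_unit i x (Suc i))) * c"
      unfolding left_weight_def sub_add_unit m_def[symmetric] c_def V_def ..
    have "left_flow q b bk k z y x S i = c *
       ((branch q b m y (add_unit i x) * ((1 - q ^ (add_unit i x i - add_unit i x (Suc i))) * l_prob q i y (add_unit i x))) * S (Suc i) +
        (branch q b m y (add_unit i x) * ((1 - q ^ (add_unit i x i - add_unit i x (Suc i))) * (1 - l_prob q i y (add_unit i x)))) * S i)"
      unfolding left_flow_def m_def[symmetric] lwx by (simp add: algebra_simps)
    also have "\<dots> = c * (E i * S (Suc i) + D i * S i)"
      unfolding step_left[where x = x and y = y and i = i and m = m, OF b i xm] E_def D_def ..
    finally show ?thesis
      unfolding c_def by (cases "odd k \<and> i = m") (auto simp: algebra_simps)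
  qed
  txt \<open>The deficit of left jumps of the last particle on an odd level equals the mass of the pulls.\<close>
  have cancel: "branch q b m y x * right_weight q bk k z x m * (1 - r_prob q m y x) =
      inverse bk * branch q bk (k div 2) (add_unit m x) z * D m" if k: "odd k"
  proof (cases "branch q b m y x = 0")
    case True
    then show ?thesis by (simp add: D_def)
  next
    case False
    have m: "m \<in> {1..m}" using k by (auto simp: m_def elim: oddE)
    have "x m \<le> y m" "m \<noteq> 1 \<Longrightarrow> y m \<le> x (m - 1)"
      using branch_neq_0_interlaced[OF False, of m] branch_neq_0_interlaced[OF False, of "m - 1"] m
      by auto
    with m have "u_plus q m x * (1 - r_prob q m y x) = 1 - q ^ (y m - x m)"
      using u_plus_r_prob(2)[of m x y] by auto
    \<comment> \<open>Reciprocity of the two level weights is what matches the deficit, carrying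
      \<open>inverse bk\<close>, with the pulled mass.\<close>
    moreover have "inverse bk * inverse b = 1"
      using bbk[OF k] by (metis inverse_1 inverse_mult_distrib)
    ultimately have "branch q b m y x * right_weight q bk k z x m * (1 - r_prob q m y x) =
       (inverse bk * inverse b) * branch q bk (k div 2) (add_unit m x) z * branch q b m y x * (1 - q ^ (y m - x m))"
      unfolding right_weight_def by (simp add: mult_ac)
    then show ?thesis by (simp add: D_def mult_ac)
  qed
  have flow: "right_flow q b bk k z y x R S i + left_flow q b bk k z y x S i =
      V * ((A i * R i + (if odd k \<and> i = m then 0 else C i) * R (Suc i)) + (D i * S i + E i * S (Suc i)))"
    if i: "i \<in> {1..m}" for i
  proof (cases "odd k \<and> i = m")
    case True
    then have "branch q b m y x * right_weight q bk k z x i * ((1 - r_prob q i y x) * S i) =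
        (inverse bk * branch q bk (k div 2) (add_unit i x) z * D i) * S i"
      using cancel by (simp add: mult.assoc[symmetric])
    then show ?thesis
      unfolding rf[OF i] lf[OF i] using True Em by (simp add: algebra_simps)
  next
    case False
    then show ?thesis
      unfolding rf[OF i] lf[OF i] by (simp only: if_False) (simp add: algebra_simps)
  qed
  define C' where "C' i = (if odd k \<and> i = m then 0 else C i)" for i
  have "(\<Sum>i=1..m. right_flow q b bk k z y x R S i + left_flow q b bk k z y x S i) +
      V * (b * branch q b m y x) * R 1 =
    V * (((\<Sum>i=1..m. A i * R i + C' i * R (Suc i)) + (b * branch q b m y x) * R 1) +
         ((\<Sum>i=1..m. D i * S i + E i * S (Suc i)) + 0 * S 1))"
    using flow by (simp add: C'_def sum.distrib[symmetric] distrib_left sum_distrib_left)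
  also have "\<dots> = V * (\<Sum>i=1..Suc m.
        ((if i \<le> m then A i else 0) + (if i = 1 then b * branch q b m y x else C' (i - 1))) * R i +
        ((if i \<le> m then D i else 0) + (if i = 1 then 0 else E (i - 1))) * S i)"
    unfolding sum_shift_coeffs by (simp only: sum.distrib)
  also have "\<dots> = V * (\<Sum>i=1..(k + 2) div 2.
        ((if i \<le> m then A i else 0) + (if i = 1 then b * branch q b m y x else C (i - 1))) * R i +
        ((if i \<le> m then D i else 0) + (if i = 1 then 0 else E (i - 1))) * S i)"
  proof (cases "odd k")
    case True
    \<comment> \<open>The surplus summand \<open>i = Suc m\<close> vanishes because
      \<open>C' m\<close> and \<open>E m\<close> are 0.\<close>
    then have "(k + 2) div 2 = m" "m \<noteq> 0" by (auto simp: m_def elim!: oddE)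
    then show ?thesis using True Em
      by (auto simp: C'_def intro!: sum.cong)
  next
    case False
    then have "(k + 2) div 2 = Suc m" by (auto simp: m_def elim!: evenE)
    then show ?thesis using False by (auto simp: C'_def intro!: sum.cong)
  qed
  also have "\<dots> = V * (\<Sum>i=1..(k + 2) div 2.
      right_weight q b (k + 1) x y i * R i + left_weight q b (k + 1) x y i * S i)"
  proof -
    have "{1..(k + 2) div 2} \<subseteq> {1..Suc m}" by (auto simp: m_def)
    then show ?thesis using rw lw by (intro arg_cong2[where f = "(*)"] sum.cong refl) auto
  qed
  finally show ?thesis unfolding m_def V_def .
qed

end

section \<open>Laws of the jumps, unit moves and levels of patterns\<close>

text \<open>The recursion only climbs. Hence a target that differs from the current configuration
  below level \<open>k\<close> has probability 0.\<close>

lemma left_jump_below: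
  "W \<in> set_pmf (left_jump n q k i Z) \<Longrightarrow> j < k \<Longrightarrow> W j = Z j"
proof (induction "2 * n - k" arbitrary: k i Z rule: less_induct)
  case less
  have IH: "W j = Y j" if "k < 2 * n" "W \<in> set_pmf (left_jump n q (Suc k) i' Y)" for i' Y
    using less(1)[OF _ that(2)] that(1) less(3) by simp
  show ?case
  proof (cases "k < 2 * n")
    case True
    then obtain i' where "W \<in> set_pmf (left_jump n q (Suc k) i' (move_left k i Z))"
      using less(2) unfolding left_jump.simps[of n q k i Z] by (auto split: if_splits)
    from IH[OF True this] show ?thesis using less(3) by (simp add: move_left_def)
  next
    case False
    then show ?thesis
      using less(2,3) unfolding left_jump.simps[of n q k i Z] by (simp add: move_left_def)
  qed
qed

lemma right_jump_below:
  "W \<in> set_pmf (right_jump n q k i Z) \<Longrightarrow> j < k \<Longrightarrow> W j = Z j"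
proof (induction "2 * n - k" arbitrary: k i Z rule: less_induct)
  case less
  have IH: "W j = Y j" if "k < 2 * n" "W \<in> set_pmf (right_jump n q (Suc k) i' Y)" for i' Y
    using less(1)[OF _ that(2)] that(1) less(3) by simp
  have L: "W j = Y j" if "W \<in> set_pmf (left_jump n q (Suc k) i' Y)" for i' Y
    using left_jump_below[OF that] less(3) by simp
  show ?case
  proof (cases "k < 2 * n")
    case True
    then obtain i' where "W \<in> set_pmf (right_jump n q (Suc k) i' (move_right k i Z)) \<or>
        W \<in> set_pmf (left_jump n q (Suc k) i' Z)"
      using less(2) unfolding right_jump.simps[of n q k i Z] by (auto split: if_splits)
    then have "W j = move_right k i Z j \<or> W j = Z j" using IH[OF True] L by blast
    then show ?thesis using less(3) by (auto simp: move_right_def)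
  next
    case False
    then show ?thesis
      using less(2,3) unfolding right_jump.simps[of n q k i Z] by (simp add: move_right_def)
  qed
qed

lemma pmf_bind_bernoulli:
  assumes "0 \<le> p" "p \<le> 1"
  shows "pmf (bind_pmf (bernoulli_pmf p) f) w = p * pmf (f True) w + (1 - p) * pmf (f False) w"
  using assms by (simp add: pmf_bind mult.commute)

lemma add_unit_eq_iff: "add_unit i x = x' \<longleftrightarrow> x' i \<noteq> 0 \<and> x = x'(i := x' i - 1)"
  by (auto simp: add_unit_def)

text \<open>The second disjunct is the truncated left jump of a particle at 0; in the sums its
  weight will be 0.\<close>

lemma dec_eq_iff: "x(i := x i - 1) = x' \<longleftrightarrow> x = add_unit i x' \<or> (x i = 0 \<and> x = x')"
  by (cases "x i = 0") (auto simp: add_unit_def fun_upd_idem)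

lemma patterns_level:
  assumes "Z \<in> patterns n" "k \<le> 2 * n"
  shows "Z k \<in> partitions ((k + 1) div 2)"
proof (cases "k = 0")
  case True
  then have "Z k = (\<lambda>_. 0)" using assms by (auto simp: patterns_def)
  then show ?thesis by (simp add: partitions_def)
next
  case False
  define l where "l = (k + 1) div 2"
  have "l \<in> {1..n}" "k = 2 * l - 1 \<or> k = 2 * l"
    using False assms(2) unfolding l_def atLeastAtMost_iff by presburger+
  then show ?thesis using assms unfolding l_def[symmetric] by (auto simp: patterns_def)
qed

lemma patterns_interlaced:
  assumes "Z \<in> patterns n" "1 \<le> k" "k < 2 * n"
  shows "Z k \<preceq> Z (Suc k)"
  using assms by (auto simp: patterns_def)

section \<open>Sums over old patterns for a fixed target pattern\<close>

locale level_sums =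
  fixes n :: nat and q :: real and a :: "nat \<Rightarrow> real" and lam :: "nat \<Rightarrow> nat" and Z' :: pattern
    and N :: nat
  assumes q0: "0 < q" and q1: "q < 1"
    and a_pos: "\<And>i. i \<in> {1..n} \<Longrightarrow> a i > 0"
    and lam: "lam \<in> partitions n" "\<And>i. lam i \<le> N"
    and Z': "Z' \<in> patterns n" "\<And>k i. Z' k i \<le> N"
begin

text \<open>Both the weight of the letter of order \<open>k\<close> and the base of the branching
  weight of level \<open>k\<close>: the exponent of \<open>a l\<close> in the monomial is the size
  increment at level \<open>2 * l - 1\<close> minus that at level \<open>2 * l\<close>.\<close>

definition level_weight :: "nat \<Rightarrow> real" where
  "level_weight k = (if odd k then a ((k + 1) div 2) else inverse (a (k div 2)))"

text \<open>The bound \<open>N\<close> only serves to keep all sums over patterns finite.\<close>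

definition tuples :: "nat \<Rightarrow> (nat \<Rightarrow> nat) set" where
  "tuples k = {x \<in> partitions ((k + 1) div 2). \<forall>i. x i \<le> N}"

text \<open>Levels \<open>k - 1\<close> and \<open>k\<close> need not interlace: level \<open>k\<close> still has its old value.\<close>

definition arrays :: "nat \<Rightarrow> pattern set" where
  "arrays k = {Z. (\<forall>j<k. Z j = Z' j) \<and> (\<forall>j\<in>{k..2 * n}. Z j \<in> tuples j) \<and>
     (\<forall>j>2 * n. Z j = (\<lambda>_. 0)) \<and> Z (2 * n) = lam}"

abbreviation link :: "pattern \<Rightarrow> nat \<Rightarrow> real" where
  "link Z k \<equiv> branch q (level_weight k) (k div 2) (Z k) (Z (k - 1))"

text \<open>Links above \<open>k\<close> belong to the old pattern, links below \<open>k\<close> to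
  the target; the link of \<open>k\<close> itself sits in \<open>right_weight\<close> and
  \<open>left_weight\<close>.\<close>

definition weight_above :: "nat \<Rightarrow> pattern \<Rightarrow> real" where
  "weight_above k Z = (\<Prod>j\<in>{k<..2 * n}. link Z j)"

definition weight_below :: "nat \<Rightarrow> real" where
  "weight_below k = (\<Prod>j<k. link Z' j)"

abbreviation right_prob :: "nat \<Rightarrow> nat \<Rightarrow> pattern \<Rightarrow> real" where
  "right_prob k i Z \<equiv> pmf (right_jump n q k i Z) Z'"

abbreviation left_prob :: "nat \<Rightarrow> nat \<Rightarrow> pattern \<Rightarrow> real" where
  "left_prob k i Z \<equiv> pmf (left_jump n q k i Z) Z'"

lemma Z'_0: "Z' 0 = (\<lambda>_. 0)" "k > 2 * n \<Longrightarrow> Z' k = (\<lambda>_. 0)"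
  using Z' by (auto simp: patterns_def)

lemma Z'_tuples: "k \<le> 2 * n \<Longrightarrow> Z' k \<in> tuples k"
  using patterns_level[OF Z'(1)] Z'(2) by (simp add: tuples_def)

lemma level_weight_neq_0: "1 \<le> k \<Longrightarrow> k \<le> 2 * n \<Longrightarrow> level_weight k \<noteq> 0"
proof -
  assume k: "1 \<le> k" "k \<le> 2 * n"
  show "level_weight k \<noteq> 0"
  proof (cases "odd k")
    case True
    then have "(k + 1) div 2 \<in> {1..n}" using k unfolding atLeastAtMost_iff by presburger
    from a_pos[OF this] show ?thesis using True by (simp add: level_weight_def)
  next
    case False
    then have "k div 2 \<in> {1..n}" using k unfolding atLeastAtMost_iff by presburger
    from a_pos[OF this] show ?thesis using False by (simp add: level_weight_def)
  qed
qed

lemma level_weight_odd: "odd k \<Longrightarrow> k < 2 * n \<Longrightarrow> level_weight k * level_weight (Suc k) = 1"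
  using level_weight_neq_0[of k] by (auto simp: level_weight_def odd_pos elim!: oddE)

text \<open>Guarantees that summing over the finite set \<open>tuples k\<close> loses no mass.
  Positions without particles are invisible to \<open>branch\<close>, hence the last
  hypothesis.\<close>

lemma tuples_lower:
  assumes y: "y \<in> tuples (Suc k)" and nz: "branch q b ((k + 1) div 2) y x \<noteq> 0"
    and x: "\<And>i. i \<notin> {1..(k + 1) div 2} \<Longrightarrow> x i = 0"
  shows "x \<in> tuples k"
proof -
  note il = branch_neq_0_interlaced[OF q0 q1 nz]
  have "x i \<le> N" for i
  proof (cases "i \<in> {1..(k + 1) div 2}")
    case True
    then have "x i \<le> y i" by (rule il)
    also have "\<dots> \<le> N" using y by (simp add: tuples_def)
    finally show ?thesis .
  qed (simp add: x)
  moreover have "x (i + 1) \<le> x i" if "i \<in> {1..<(k + 1) div 2}" for i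
    using il(1)[of "Suc i"] il(2)[of i] that by simp
  ultimately show ?thesis using x by (auto simp: tuples_def partitions_def)
qed

lemma finite_tuples: "finite (tuples k)"
proof -
  have "finite {f. \<forall>i. (i \<in> {1..(k + 1) div 2} \<longrightarrow> f i \<in> {..N}) \<and> (i \<notin> {1..(k + 1) div 2} \<longrightarrow> f i = 0)}"
    by (rule finite_set_of_finite_funs) simp_all
  then show ?thesis
    by (rule rev_finite_subset) (auto simp: tuples_def partitions_def)
qed

lemma finite_arrays: "finite (arrays 0)"
proof -
  have "finite {Z. \<forall>j. (j \<in> {..2 * n} \<longrightarrow> Z j \<in> (\<Union>k\<le>2 * n. tuples k)) \<and>
      (j \<notin> {..2 * n} \<longrightarrow> Z j = (\<lambda>_. 0))}"
    by (rule finite_set_of_finite_funs) (simp_all add: finite_tuples)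
  then show ?thesis
    by (rule rev_finite_subset) (fastforce simp: arrays_def)
qed

lemma arrays_Suc_subset: "arrays k \<subseteq> arrays 0" if "k \<le> 2 * n"
  using Z'_tuples that by (auto simp: arrays_def)

lemma arrays_Suc_at: "Y \<in> arrays (Suc k) \<Longrightarrow> Y k = Z' k"
  by (simp add: arrays_def)

text \<open>Level \<open>k\<close> is free in \<open>arrays k\<close> and fixed in
  \<open>arrays (Suc k)\<close>; the bijection stores its free value separately. The bound on
  \<open>k\<close> is strict because the top level is pinned to \<open>lam\<close>.\<close>

lemma sum_arrays_Suc:
  assumes k: "k < 2 * n"
  shows "(\<Sum>Z\<in>arrays k. g Z) = (\<Sum>Y\<in>arrays (Suc k). \<Sum>x\<in>tuples k. g (Y(k := x)) :: real)"
proof -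
  have "(\<Sum>(Y, x)\<in>arrays (Suc k) \<times> tuples k. g (Y(k := x))) = (\<Sum>Z\<in>arrays k. g Z)"
  proof (rule sum.reindex_bij_witness[where j = "\<lambda>(Y, x). Y(k := x)" and i = "\<lambda>Z. (Z(k := Z' k), Z k)"])
    fix p assume p: "p \<in> arrays (Suc k) \<times> tuples k"
    obtain Y x where [simp]: "p = (Y, x)" by (cases p)
    have Y: "Y \<in> arrays (Suc k)" and x: "x \<in> tuples k" using p by auto
    show "(\<lambda>Z. (Z(k := Z' k), Z k)) ((\<lambda>(Y, x). Y(k := x)) p) = p"
      using arrays_Suc_at[OF Y] by (simp add: fun_upd_idem)
    show "(\<lambda>(Y, x). Y(k := x)) p \<in> arrays k"
      using Y x k by (simp add: arrays_def)
  next
    fix Z assume Z: "Z \<in> arrays k"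
    show "(\<lambda>Z. (Z(k := Z' k), Z k)) Z \<in> arrays (Suc k) \<times> tuples k"
      using Z k by (simp add: arrays_def less_Suc_eq)
  qed auto
  then show ?thesis by (simp add: sum.cartesian_product)
qed

lemma weight_above_upd:
  assumes "k < 2 * n"
  shows "weight_above k (Y(k := x)) = branch q (level_weight (Suc k)) ((k + 1) div 2) (Y (Suc k)) x * weight_above (Suc k) Y"
proof -
  have "{k<..2 * n} = insert (Suc k) {Suc k<..2 * n}" using assms by auto
  then have 1: "weight_above k (Y(k := x)) = link (Y(k := x)) (Suc k) * (\<Prod>j\<in>{Suc k<..2 * n}. link (Y(k := x)) j)"
    unfolding weight_above_def by simp
  have 2: "(\<Prod>j\<in>{Suc k<..2 * n}. link (Y(k := x)) j) = weight_above (Suc k) Y"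
    unfolding weight_above_def by (rule prod.cong) auto
  show ?thesis unfolding 1 2 by simp
qed

section \<open>One step of the insertion\<close>

lemma right_prob_eq_0: "j < k \<Longrightarrow> Z j \<noteq> Z' j \<Longrightarrow> right_prob k i Z = 0"
  and left_prob_eq_0: "j < k \<Longrightarrow> Z j \<noteq> Z' j \<Longrightarrow> left_prob k i Z = 0"
  using right_jump_below left_jump_below by (metis set_pmf_iff)+

lemma right_prob_upd: "Y k = Z' k \<Longrightarrow> right_prob (Suc k) i (Y(k := v)) = (if v = Z' k then right_prob (Suc k) i Y else 0)"
  and left_prob_upd: "Y k = Z' k \<Longrightarrow> left_prob (Suc k) i (Y(k := v)) = (if v = Z' k then left_prob (Suc k) i Y else 0)"
  by (auto simp: right_prob_eq_0[of k] left_prob_eq_0[of k] fun_upd_idem)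

text \<open>The interlacing hypotheses place \<open>r\<close> in the unit interval, where
  \<open>bernoulli_pmf r\<close> has success probability \<open>r\<close>. The last summand is the
  suppressed jump, which leaves level \<open>k\<close> at \<open>x\<close>.\<close>

lemma right_prob_step:
  assumes k: "k < 2 * n" and Y: "Y k = Z' k" and i: "1 \<le> i"
    and il: "x i \<le> Y (Suc k) i" "i = 1 \<or> Y (Suc k) i \<le> x (i - 1)"
  defines "r \<equiv> r_prob q i (Y (Suc k)) x"
  shows "right_prob k i (Y(k := x)) =
    (if add_unit i x = Z' k then r * right_prob (Suc k) i Y +
       (if odd k \<and> i = (k + 1) div 2 then 0 else (1 - r) * right_prob (Suc k) (Suc i) Y) else 0) +
    (if odd k \<and> i = (k + 1) div 2 then if x = Z' k then (1 - r) * left_prob (Suc k) i Y else 0 else 0)"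
proof -
  have m: "move_right k i (Y(k := x)) = Y(k := add_unit i x)"
    by (simp add: move_right_def add_unit_def)
  have r: "0 \<le> r" "r \<le> 1"
    unfolding r_def using u_plus_r_prob(3,4)[OF q0 q1, where x = x and y = "Y (Suc k)" and i = i, OF i il(1)] il(2)
    by auto
  have r': "r_prob q i ((Y(k := x)) (k + 1)) ((Y(k := x)) k) = r" by (simp add: r_def)
  show ?thesis
    unfolding right_jump.simps[of n q k i "Y(k := x)"] r' m
    using k r by (simp add: pmf_bind_bernoulli right_prob_upd[where Y = Y and k = k, OF Y] left_prob_upd[where Y = Y and k = k, OF Y])
qed

lemma left_prob_step:
  assumes k: "k < 2 * n" and Y: "Y k = Z' k"
    and il: "x (Suc i) \<le> Y (Suc k) (Suc i)" "Y (Suc k) (Suc i) \<le> x i"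
  defines "l \<equiv> l_prob q i (Y (Suc k)) x"
  shows "left_prob k i (Y(k := x)) =
    (if x(i := x i - 1) = Z' k then l * left_prob (Suc k) (Suc i) Y + (1 - l) * left_prob (Suc k) i Y else 0)"
proof -
  have m: "move_left k i (Y(k := x)) = Y(k := x(i := x i - 1))"
    by (simp add: move_left_def)
  have l: "0 \<le> l" "l \<le> 1"
    unfolding l_def using u_minus_l_prob(3,4)[OF q0 q1, where x = x and y = "Y (Suc k)" and i = i, OF il] by auto
  have l': "l_prob q i ((Y(k := x)) (k + 1)) ((Y(k := x)) k) = l" by (simp add: l_def)
  show ?thesis
    unfolding left_jump.simps[of n q k i "Y(k := x)"] l' m
    using k l by (simp add: pmf_bind_bernoulli left_prob_upd[where Y = Y and k = k, OF Y])
qed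

text \<open>At most two old values of level \<open>k\<close> lead to the target: the target lowered
  at \<open>i\<close>, by a performed jump, and the target itself, by a suppressed one.\<close>

lemma sum_right:
  assumes k: "k < 2 * n" and Y: "Y \<in> arrays (Suc k)" and i: "i \<in> {1..(k + 1) div 2}"
  shows "(\<Sum>x\<in>tuples k. branch q (level_weight (Suc k)) ((k + 1) div 2) (Y (Suc k)) x *
      (right_weight q (level_weight k) k z x i * right_prob k i (Y(k := x)))) =
    right_flow q (level_weight (Suc k)) (level_weight k) k z (Y (Suc k)) (Z' k) (\<lambda>i. right_prob (Suc k) i Y) (\<lambda>i. left_prob (Suc k) i Y) i"
proof -
  let ?w = "branch q (level_weight (Suc k)) ((k + 1) div 2) (Y (Suc k))"
  let ?x' = "Z' k" and ?last = "odd k \<and> i = (k + 1) div 2"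
  let ?x0 = "(Z' k)(i := Z' k i - 1)"
  let ?r = "\<lambda>x. r_prob q i (Y (Suc k)) x"
  have x': "?x' \<in> tuples k" using Z'_tuples k by simp
  have x'0: "Z' k j = 0" if "j \<notin> {1..(k + 1) div 2}" for j
    using x' that unfolding tuples_def by (auto intro: partitions_outside)
  have Yk: "Y (Suc k) \<in> tuples (Suc k)" using Y k by (simp add: arrays_def)
  have aux: "w * (g * ((if \<not> z \<and> d then E else 0) + (if L then if e then F else 0 else 0))) =
      (if d then (if z then 0 else w * g * E) else 0) + (if e then (if L then w * g * F else 0) else 0)"
    for w g E F :: real and z d e L by (simp add: distrib_left mult.assoc)
  have "?w x * (right_weight q (level_weight k) k z x i * right_prob k i (Y(k := x))) =
     (if x = ?x0 then (if ?x' i = 0 then 0 else ?w x * right_weight q (level_weight k) k z x i *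
        (?r x * right_prob (Suc k) i Y + (if ?last then 0 else (1 - ?r x) * right_prob (Suc k) (Suc i) Y))) else 0) +
     (if x = ?x' then (if ?last then ?w x * right_weight q (level_weight k) k z x i * ((1 - ?r x) * left_prob (Suc k) i Y) else 0) else 0)"
    if x: "x \<in> tuples k" for x
  proof (cases "?w x = 0")
    case False
    note il = branch_neq_0_interlaced[OF q0 q1 False]
    have "i \<noteq> 1 \<Longrightarrow> i - 1 \<in> {1..(k + 1) div 2}" "i \<noteq> 1 \<Longrightarrow> Suc (i - 1) = i" using i by auto
    then have il': "x i \<le> Y (Suc k) i" "i = 1 \<or> Y (Suc k) i \<le> x (i - 1)"
      using il(1)[of i] il(2)[of "i - 1"] i by auto
    have i1: "1 \<le> i" using i by simp
    show ?thesis
      unfolding right_prob_step[where x = x and Y = Y, OF k arrays_Suc_at[OF Y] i1 il'] add_unit_eq_iff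
      by (rule aux)
  qed auto
  then have "(\<Sum>x\<in>tuples k. ?w x * (right_weight q (level_weight k) k z x i * right_prob k i (Y(k := x)))) =
     (if ?x0 \<in> tuples k then (if ?x' i = 0 then 0 else ?w ?x0 * right_weight q (level_weight k) k z ?x0 i *
        (?r ?x0 * right_prob (Suc k) i Y + (if ?last then 0 else (1 - ?r ?x0) * right_prob (Suc k) (Suc i) Y))) else 0) +
     (if ?last then ?w ?x' * right_weight q (level_weight k) k z ?x' i * ((1 - ?r ?x') * left_prob (Suc k) i Y) else 0)"
    using x' by (simp add: sum.distrib finite_tuples)
  moreover have "?w ?x0 = 0" if "?x0 \<notin> tuples k"
  proof (rule ccontr)
    assume "?w ?x0 \<noteq> 0"
    then have "?x0 \<in> tuples k"
      by (rule tuples_lower[OF Yk]) (use x'0 i in auto)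
    with that show False ..
  qed
  ultimately show ?thesis
    unfolding right_flow_def by auto
qed

lemma sum_left:
  assumes k: "k < 2 * n" and Y: "Y \<in> arrays (Suc k)" and i: "i \<in> {1..(k + 1) div 2}"
  shows "(\<Sum>x\<in>tuples k. branch q (level_weight (Suc k)) ((k + 1) div 2) (Y (Suc k)) x *
      (left_weight q (level_weight k) k z x i * left_prob k i (Y(k := x)))) =
    left_flow q (level_weight (Suc k)) (level_weight k) k z (Y (Suc k)) (Z' k) (\<lambda>i. left_prob (Suc k) i Y) i"
proof -
  let ?w = "branch q (level_weight (Suc k)) ((k + 1) div 2) (Y (Suc k))"
  let ?x0 = "add_unit i (Z' k)"
  let ?l = "\<lambda>x. l_prob q i (Y (Suc k)) x"
  have x': "Z' k \<in> tuples k" using Z'_tuples k by simp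
  have x'0: "Z' k j = 0" if "j \<notin> {1..(k + 1) div 2}" for j
    using x' that unfolding tuples_def by (auto intro: partitions_outside)
  have Yk: "Y (Suc k) \<in> tuples (Suc k)" using Y k by (simp add: arrays_def)
  have aux: "w * (g * (if d then E else 0)) = (if d then w * g * E else 0)"
    for w g E :: real and d by simp
  have "?w x * (left_weight q (level_weight k) k z x i * left_prob k i (Y(k := x))) =
     (if x = ?x0 then ?w x * left_weight q (level_weight k) k z x i *
        (?l x * left_prob (Suc k) (Suc i) Y + (1 - ?l x) * left_prob (Suc k) i Y) else 0)"
    if x: "x \<in> tuples k" for x
  proof (cases "?w x = 0 \<or> x i = 0")
    case False
    then have nz: "?w x \<noteq> 0" by simp
    note il = branch_neq_0_interlaced[OF q0 q1 nz]
    have sY: "x (Suc i) \<le> Y (Suc k) (Suc i)"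
    proof (cases "Suc i \<in> {1..(k + 1) div 2}")
      case True
      then show ?thesis by (rule il)
    next
      case False
      then have "x (Suc i) = 0" using x by (simp add: tuples_def partitions_def)
      then show ?thesis by simp
    qed
    have x0: "(x = ?x0 \<or> x i = 0 \<and> x = Z' k) = (x = ?x0)" using False by simp
    show ?thesis
      unfolding left_prob_step[where x = x and Y = Y and i = i, OF k arrays_Suc_at[OF Y] sY il(2)[OF i]]
        dec_eq_iff x0 by (rule aux)
  next
    case True
    \<comment> \<open>At \<open>x i = 0\<close> the truncated jump might reach the target as well,
      but \<open>left_weight\<close> contains the factor \<open>1 - q ^ 0\<close>.\<close>
    then show ?thesis by (auto simp: left_weight_def add_unit_def)
  qed
  then have "(\<Sum>x\<in>tuples k. ?w x * (left_weight q (level_weight k) k z x i * left_prob k i (Y(k := x)))) =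
     (if ?x0 \<in> tuples k then ?w ?x0 * left_weight q (level_weight k) k z ?x0 i *
        (?l ?x0 * left_prob (Suc k) (Suc i) Y + (1 - ?l ?x0) * left_prob (Suc k) i Y) else 0)"
    by (simp add: finite_tuples)
  moreover have "?w ?x0 = 0" if "?x0 \<notin> tuples k"
  proof (rule ccontr)
    assume "?w ?x0 \<noteq> 0"
    then have "?x0 \<in> tuples k"
      by (rule tuples_lower[OF Yk]) (use x'0 i in \<open>auto simp: add_unit_def\<close>)
    with that show False ..
  qed
  ultimately show ?thesis
    unfolding left_flow_def by auto
qed

section \<open>Recursion of the total flow over the levels\<close>

text \<open>The candidate for the total mass of jumps pending on level \<open>k\<close>, in terms of
  the closed-form weights. That it collects the letters of order at most \<open>k\<close> is
  \<open>flow_eq_fresh\<close>.\<close>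

definition flow :: "nat \<Rightarrow> real" where
  "flow k = weight_below k * (\<Sum>Z\<in>arrays k. weight_above k Z * (\<Sum>i=1..(k + 1) div 2.
     right_weight q (level_weight k) k (Z' (k - 1)) (Z k) i * right_prob k i Z +
     left_weight q (level_weight k) k (Z' (k - 1)) (Z k) i * left_prob k i Z))"

text \<open>The contribution of the letter of order \<open>k\<close> to the left-hand side of the
  theorem; \<open>weight_above 0\<close> is the full weight in \<open>K\<close>.\<close>

definition fresh :: "nat \<Rightarrow> real" where
  "fresh k = level_weight k * (\<Sum>Z\<in>arrays 0. weight_above 0 Z * right_prob k 1 Z)"

lemma weight_below_Suc: "weight_below (Suc k) = weight_below k * link Z' k"
  by (simp add: weight_below_def)

text \<open>As \<open>0 - 1 = 0\<close>, the link of level 0 compares the empty level with itself: a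
  dummy factor.\<close>

lemma link_Z'_0: "branch q (level_weight 0) 0 (Z' 0) (Z' 0) = 1"
  by (simp add: branch_def psize_def Z'_0)

lemma weight_above_0_agree:
  assumes "Z \<in> arrays (Suc k)" "k < 2 * n"
  shows "weight_above 0 Z = weight_below (Suc k) * (branch q (level_weight (Suc k)) ((k + 1) div 2) (Z (Suc k)) (Z' k) * weight_above (Suc k) Z)"
proof -
  have Z: "Z j = Z' j" if "j \<le> k" for j using that assms by (simp add: arrays_def)
  have "{0<..2 * n} = {0<..k} \<union> insert (Suc k) {Suc k<..2 * n}" using assms by auto
  then have "weight_above 0 Z = (\<Prod>j\<in>{0<..k}. link Z j) * (link Z (Suc k) * weight_above (Suc k) Z)"
    unfolding weight_above_def by (simp add: prod.union_disjoint)
  moreover have "(\<Prod>j\<in>{0<..k}. link Z j) = (\<Prod>j\<in>{0<..k}. link Z' j)"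
    by (rule prod.cong) (auto simp: Z)
  moreover have "weight_below (Suc k) = (\<Prod>j\<in>{0<..k}. link Z' j)"
  proof -
    have "{..<Suc k} = insert 0 {0<..k}" by auto
    then show ?thesis unfolding weight_below_def by (simp add: link_Z'_0)
  qed
  moreover have "Z k = Z' k" by (rule Z) simp
  ultimately show ?thesis by simp
qed

text \<open>This letter never touches levels up to \<open>k\<close>, so only old patterns agreeing
  there with the target contribute, and their links up to level \<open>k\<close> factor out.\<close>

lemma fresh_Suc:
  assumes k: "k < 2 * n"
  shows "fresh (Suc k) = weight_below (Suc k) * (\<Sum>Y\<in>arrays (Suc k). weight_above (Suc k) Y *
    (level_weight (Suc k) * branch q (level_weight (Suc k)) ((k + 1) div 2) (Y (Suc k)) (Z' k) * right_prob (Suc k) 1 Y))"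
proof -
  have "(\<Sum>Z\<in>arrays 0. weight_above 0 Z * right_prob (Suc k) 1 Z) = (\<Sum>Z\<in>arrays (Suc k). weight_above 0 Z * right_prob (Suc k) 1 Z)"
  proof (rule sum.mono_neutral_right[OF finite_arrays arrays_Suc_subset])
    show "\<forall>Z\<in>arrays 0 - arrays (Suc k). weight_above 0 Z * right_prob (Suc k) 1 Z = 0"
    proof
      fix Z assume "Z \<in> arrays 0 - arrays (Suc k)"
      then obtain j where "j < Suc k" "Z j \<noteq> Z' j" by (auto simp: arrays_def)
      then show "weight_above 0 Z * right_prob (Suc k) 1 Z = 0" by (simp add: right_prob_eq_0)
    qed
  qed (use k in simp)
  also have "\<dots> = (\<Sum>Z\<in>arrays (Suc k). weight_below (Suc k) * (weight_above (Suc k) Z *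
      (branch q (level_weight (Suc k)) ((k + 1) div 2) (Z (Suc k)) (Z' k) * right_prob (Suc k) 1 Z)))"
    by (rule sum.cong) (simp_all add: weight_above_0_agree[OF _ k])
  finally show ?thesis
    by (simp add: fresh_def sum_distrib_left mult_ac)
qed

text \<open>For fixed higher levels, summing out level \<open>k\<close> gives
  \<open>right_flow\<close> and \<open>left_flow\<close>. Then \<open>flow_balance\<close> adds the
  new letter and returns the weights of level \<open>Suc k\<close>, times \<open>link Z' k\<close>,
  which joins \<open>weight_below\<close>.\<close>

lemma flow_Suc:
  assumes k: "k < 2 * n"
  shows "flow k + fresh (Suc k) = flow (Suc k)"
proof -
  have sum_combine: "B * (\<Sum>Y\<in>A. f Y) + B * L * (\<Sum>Y\<in>A. g Y) = B * (\<Sum>Y\<in>A. f Y + L * g Y)"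
    for B L :: real and f g :: "pattern \<Rightarrow> real" and A
    by (simp add: sum.distrib sum_distrib_left distrib_left mult.assoc)
  define w where "w Y = branch q (level_weight (Suc k)) ((k + 1) div 2) (Y (Suc k))" for Y :: pattern
  let ?z = "Z' (k - 1)"
  have inner: "(\<Sum>x\<in>tuples k. weight_above k (Y(k := x)) * (\<Sum>i=1..(k + 1) div 2.
       right_weight q (level_weight k) k ?z x i * right_prob k i (Y(k := x)) +
       left_weight q (level_weight k) k ?z x i * left_prob k i (Y(k := x)))) +
     link Z' k * (weight_above (Suc k) Y * (level_weight (Suc k) * w Y (Z' k) * right_prob (Suc k) 1 Y)) =
     link Z' k * (weight_above (Suc k) Y * (\<Sum>i=1..(k + 2) div 2.
       right_weight q (level_weight (Suc k)) (k + 1) (Z' k) (Y (Suc k)) i * right_prob (Suc k) i Y +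
       left_weight q (level_weight (Suc k)) (k + 1) (Z' k) (Y (Suc k)) i * left_prob (Suc k) i Y))"
    if Y: "Y \<in> arrays (Suc k)" for Y
  proof -
    let ?rf = "right_flow q (level_weight (Suc k)) (level_weight k) k ?z (Y (Suc k)) (Z' k) (\<lambda>i. right_prob (Suc k) i Y) (\<lambda>i. left_prob (Suc k) i Y)"
    let ?lf = "left_flow q (level_weight (Suc k)) (level_weight k) k ?z (Y (Suc k)) (Z' k) (\<lambda>i. left_prob (Suc k) i Y)"
    have "(\<Sum>x\<in>tuples k. weight_above k (Y(k := x)) * (\<Sum>i=1..(k + 1) div 2.
       right_weight q (level_weight k) k ?z x i * right_prob k i (Y(k := x)) +
       left_weight q (level_weight k) k ?z x i * left_prob k i (Y(k := x)))) =
      weight_above (Suc k) Y * (\<Sum>x\<in>tuples k. \<Sum>i=1..(k + 1) div 2.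
       w Y x * (right_weight q (level_weight k) k ?z x i * right_prob k i (Y(k := x))) +
       w Y x * (left_weight q (level_weight k) k ?z x i * left_prob k i (Y(k := x))))"
      unfolding sum_distrib_left
      by (intro sum.cong refl) (simp add: weight_above_upd[OF k] w_def algebra_simps)
    also have "(\<Sum>x\<in>tuples k. \<Sum>i=1..(k + 1) div 2.
       w Y x * (right_weight q (level_weight k) k ?z x i * right_prob k i (Y(k := x))) +
       w Y x * (left_weight q (level_weight k) k ?z x i * left_prob k i (Y(k := x)))) =
      (\<Sum>i=1..(k + 1) div 2. ?rf i + ?lf i)"
      unfolding w_def
      by (subst sum.swap) (intro sum.cong refl, simp only: sum.distrib sum_right[OF k Y] sum_left[OF k Y])
    finally have 1: "(\<Sum>x\<in>tuples k. weight_above k (Y(k := x)) * (\<Sum>i=1..(k + 1) div 2.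
       right_weight q (level_weight k) k ?z x i * right_prob k i (Y(k := x)) +
       left_weight q (level_weight k) k ?z x i * left_prob k i (Y(k := x)))) =
       weight_above (Suc k) Y * (\<Sum>i=1..(k + 1) div 2. ?rf i + ?lf i)" .
    have "Y (Suc k) \<in> tuples (Suc k)" using Y k by (simp add: arrays_def)
    then have "Z' k \<in> partitions ((k + 1) div 2)" "Y (Suc k) \<in> partitions ((k + 2) div 2)"
      using Z'_tuples[of k] k by (auto simp: tuples_def)
    moreover have "level_weight (Suc k) \<noteq> 0" "odd k \<Longrightarrow> level_weight k * level_weight (Suc k) = 1"
      using level_weight_neq_0[of "Suc k"] level_weight_odd k by auto
    ultimately have 2: "(\<Sum>i=1..(k + 1) div 2. ?rf i + ?lf i) +
       link Z' k * (level_weight (Suc k) * w Y (Z' k)) * right_prob (Suc k) 1 Y =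
       link Z' k * (\<Sum>i=1..(k + 2) div 2.
       right_weight q (level_weight (Suc k)) (k + 1) (Z' k) (Y (Suc k)) i * right_prob (Suc k) i Y +
       left_weight q (level_weight (Suc k)) (k + 1) (Z' k) (Y (Suc k)) i * left_prob (Suc k) i Y)"
      unfolding w_def by (intro flow_balance[OF q0 q1])
    have "weight_above (Suc k) Y * ((\<Sum>i=1..(k + 1) div 2. ?rf i + ?lf i) +
       link Z' k * (level_weight (Suc k) * w Y (Z' k)) * right_prob (Suc k) 1 Y) =
       link Z' k * (weight_above (Suc k) Y * (\<Sum>i=1..(k + 2) div 2.
       right_weight q (level_weight (Suc k)) (k + 1) (Z' k) (Y (Suc k)) i * right_prob (Suc k) i Y +
       left_weight q (level_weight (Suc k)) (k + 1) (Z' k) (Y (Suc k)) i * left_prob (Suc k) i Y))"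
      unfolding 2 by (simp only: mult_ac)
    then show ?thesis unfolding 1 by (simp add: distrib_left mult_ac)
  qed
  have "flow k + fresh (Suc k) = weight_below k * (\<Sum>Y\<in>arrays (Suc k).
     (\<Sum>x\<in>tuples k. weight_above k (Y(k := x)) * (\<Sum>i=1..(k + 1) div 2.
       right_weight q (level_weight k) k ?z x i * right_prob k i (Y(k := x)) +
       left_weight q (level_weight k) k ?z x i * left_prob k i (Y(k := x)))) +
     link Z' k * (weight_above (Suc k) Y * (level_weight (Suc k) * w Y (Z' k) * right_prob (Suc k) 1 Y)))"
    unfolding flow_def sum_arrays_Suc[OF k] fresh_Suc[OF k] weight_below_Suc w_def fun_upd_same
    by (rule sum_combine)
  also have "\<dots> = weight_below k * link Z' k * (\<Sum>Y\<in>arrays (Suc k). weight_above (Suc k) Y * (\<Sum>i=1..(k + 2) div 2.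
       right_weight q (level_weight (Suc k)) (k + 1) (Z' k) (Y (Suc k)) i * right_prob (Suc k) i Y +
       left_weight q (level_weight (Suc k)) (k + 1) (Z' k) (Y (Suc k)) i * left_prob (Suc k) i Y))"
    unfolding mult.assoc[of "weight_below k"] sum_distrib_left[of "link Z' k"]
    by (intro arg_cong2[where f = "(*)"] sum.cong refl inner)
  also have "\<dots> = flow (Suc k)"
    by (simp add: flow_def weight_below_Suc)
  finally show ?thesis .
qed

lemma flow_0: "flow 0 = 0"
  by (simp add: flow_def)

lemma flow_eq_fresh: "k \<le> 2 * n \<Longrightarrow> flow k = (\<Sum>j=1..k. fresh j)"
proof (induction k)
  case (Suc k)
  then show ?case using flow_Suc[of k] by simp
qed (simp add: flow_0)

section \<open>The top level and the entries of L\<close>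

lemma arrays_top: "arrays (2 * n) = {Z'(2 * n := lam)}"
proof -
  have "lam \<in> tuples (2 * n)" using lam by (simp add: tuples_def)
  then have "Z'(2 * n := lam) \<in> arrays (2 * n)"
    using Z'_0(2) by (simp add: arrays_def)
  moreover have "Z = Z'(2 * n := lam)" if "Z \<in> arrays (2 * n)" for Z
  proof
    fix j
    show "Z j = (Z'(2 * n := lam)) j"
      using that Z'_0(2)[of j] by (cases j "2 * n" rule: linorder_cases) (simp_all add: arrays_def)
  qed
  ultimately show ?thesis by blast
qed

lemma weight_above_0_Z': "weight_above 0 Z' = weight_below (2 * n) * link Z' (2 * n)" if "n \<ge> 1"
proof -
  have "{0<..2 * n} = insert (2 * n) {0<..<2 * n}" "{..<2 * n} = insert 0 {0<..<2 * n}"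
    using that by auto
  then show ?thesis
    by (simp add: weight_above_def weight_below_def link_Z'_0 mult.commute)
qed

text \<open>On level \<open>2 * n\<close> a pending jump is simply carried out. The shifted
  branching weight is thus taken at the target and completes \<open>weight_below\<close> to the
  weight of \<open>Z'\<close>; on this even level \<open>left_weight\<close> has no deficit.\<close>

lemma flow_top:
  assumes n: "n \<ge> 1"
  shows "flow (2 * n) = kernel_L n q lam (Z' (2 * n)) * weight_above 0 Z'"
proof -
  let ?w = "\<lambda>x. branch q (level_weight (2 * n)) n x (Z' (2 * n - 1))"
  let ?t = "Z' (2 * n)"
  have lamn: "lam (Suc n) = 0" using partitions_outside[OF lam(1)] by simp
  have R: "right_prob (2 * n) i (Z'(2 * n := lam)) = of_bool (?t = add_unit i lam)" for i
  proof -
    have "move_right (2 * n) i (Z'(2 * n := lam)) = Z'(2 * n := add_unit i lam)"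
      by (simp add: move_right_def add_unit_def)
    then have "right_prob (2 * n) i (Z'(2 * n := lam)) = of_bool (Z' = Z'(2 * n := add_unit i lam))"
      unfolding right_jump.simps[of n q "2 * n"] by (simp add: pmf_return indicator_def)
    also have "Z' = Z'(2 * n := add_unit i lam) \<longleftrightarrow> ?t = add_unit i lam"
      by (metis fun_upd_same fun_upd_triv)
    finally show ?thesis .
  qed
  have L: "left_prob (2 * n) i (Z'(2 * n := lam)) = of_bool (lam = add_unit i ?t \<or> lam i = 0 \<and> lam = ?t)" for i
  proof -
    have "move_left (2 * n) i (Z'(2 * n := lam)) = Z'(2 * n := lam(i := lam i - 1))"
      by (simp add: move_left_def)
    then have "left_prob (2 * n) i (Z'(2 * n := lam)) = of_bool (Z' = Z'(2 * n := lam(i := lam i - 1)))"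
      unfolding left_jump.simps[of n q "2 * n"] by (simp add: pmf_return indicator_def)
    also have "Z' = Z'(2 * n := lam(i := lam i - 1)) \<longleftrightarrow> lam(i := lam i - 1) = ?t"
      by (metis fun_upd_same fun_upd_triv)
    finally show ?thesis unfolding dec_eq_iff .
  qed
  have R': "right_weight q (level_weight (2 * n)) (2 * n) (Z' (2 * n - 1)) lam i * right_prob (2 * n) i (Z'(2 * n := lam)) =
      (if ?t = add_unit i lam then u_plus q i lam else 0) * ?w ?t" for i
    unfolding R right_weight_def by auto
  have L': "left_weight q (level_weight (2 * n)) (2 * n) (Z' (2 * n - 1)) lam i * left_prob (2 * n) i (Z'(2 * n := lam)) =
      (if lam = add_unit i ?t then u_minus n q i lam else 0) * ?w ?t" if "i \<in> {1..n}" for i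
  proof -
    \<comment> \<open>Coordinate \<open>n + 1\<close> of \<open>lam\<close> is 0, which merges the
      two cases of \<open>u_minus\<close>.\<close>
    have "u_minus n q i lam = 1 - q ^ (lam i - lam (Suc i))"
      using lamn by (auto simp: u_minus_def)
    moreover have "lam(i := lam i - 1) = ?t" if "lam = add_unit i ?t"
      using that dec_eq_iff by blast
    ultimately show ?thesis
      unfolding L left_weight_def by auto
  qed
  have "flow (2 * n) = weight_below (2 * n) * (\<Sum>i=1..n.
      right_weight q (level_weight (2 * n)) (2 * n) (Z' (2 * n - 1)) lam i * right_prob (2 * n) i (Z'(2 * n := lam)) +
      left_weight q (level_weight (2 * n)) (2 * n) (Z' (2 * n - 1)) lam i * left_prob (2 * n) i (Z'(2 * n := lam)))"
    by (simp add: flow_def arrays_top weight_above_def)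
  also have "\<dots> = weight_below (2 * n) * (kernel_L n q lam ?t * ?w ?t)"
    unfolding kernel_L_def sum_distrib_right distrib_right
    by (intro arg_cong2[where f = "(*)"] arg_cong2[where f = "(+)"] sum.cong refl R' L')
  finally show ?thesis
    by (simp add: weight_above_0_Z'[OF n])
qed

section \<open>Identification with the kernel sums\<close>

lemma prod_pairs: "(\<Prod>k=1..2 * m. f k) = (\<Prod>l=1..m::nat. f (2 * l - 1) * f (2 * l) :: real)"
  by (induction m) (simp_all add: mult.assoc)

lemma sum_pairs: "(\<Sum>k=1..2 * m. f k) = (\<Sum>l=1..m::nat. f (2 * l - 1) + f (2 * l) :: real)"
  by (induction m) (simp_all add: add.assoc)

lemma kernel_M_eq: "kernel_M n q a Z Z' = (\<Sum>k=1..2 * n. level_weight k * right_prob k 1 Z)"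
proof -
  have "kernel_M n q a Z Z' = (\<Sum>l=1..n. a l * right_prob (2 * l - 1) 1 Z) + (\<Sum>l=1..n. inverse (a l) * right_prob (2 * l) 1 Z)"
    unfolding kernel_M_def letters_def
    by (subst sum.union_disjoint) (auto simp: sum.reindex inj_on_def q_insertion_def)
  also have "\<dots> = (\<Sum>l=1..n. level_weight (2 * l - 1) * right_prob (2 * l - 1) 1 Z + level_weight (2 * l) * right_prob (2 * l) 1 Z)"
    unfolding sum.distrib[symmetric] by (rule sum.cong) (auto simp: level_weight_def)
  finally show ?thesis unfolding sum_pairs .
qed

text \<open>Both \<open>kappa\<close> and the monomial group the levels \<open>2 * l - 1\<close> and
  \<open>2 * l\<close>; regrouping level by level gives the links. Interlacing ensures that
  \<open>qbin_gap\<close> is the q-binomial and not the default 0.\<close>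

lemma weight_patterns:
  assumes Z: "Z \<in> patterns n"
  shows "pattern_monomial n a Z * kappa n q Z = weight_above 0 Z"
proof -
  let ?g = "\<lambda>k i. qbin_gap q (Z k i) (Z (k - 1) i) (Z k (Suc i))"
  have out: "Z k (Suc i) = 0" if "k \<le> 2 * n" "(k + 1) div 2 \<le> i" for k i
    using partitions_outside[OF patterns_level[OF Z that(1)], of "Suc i"] that(2) by simp
  have il: "Z k i \<le> Z (Suc k) i" "Z (Suc k) (Suc i) \<le> Z k i" if "1 \<le> k" "k < 2 * n" "1 \<le> i" for k i
    using patterns_interlaced[OF Z that(1,2)] that(3) by (auto simp: interlaced_def)
  have gap: "qbinomial q (Z (Suc k) i - Z (Suc k) (Suc i)) (Z (Suc k) i - Z k i) = ?g (Suc k) i"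
    if "1 \<le> k" "k < 2 * n" "1 \<le> i" for k i
    using il[OF that] by (simp add: qbin_gap_def)
  have "a l powi (2 * int (psize l (Z (2 * l - 1))) - int (psize l (Z (2 * l))) - int (psize (l - 1) (Z (2 * l - 2)))) *
     ((\<Prod>i=1..l - 1.
        qbinomial q (Z (2 * l - 1) i - Z (2 * l - 1) (i + 1)) (Z (2 * l - 1) i - Z (2 * l - 2) i) *
        qbinomial q (Z (2 * l) i - Z (2 * l) (i + 1)) (Z (2 * l) i - Z (2 * l - 1) i)) *
     qbinomial q (Z (2 * l) l) (Z (2 * l) l - Z (2 * l - 1) l)) =
     link Z (2 * l - 1) * link Z (2 * l)" if l: "l \<in> {1..n}" for l
  proof -
    obtain p where p: "l = Suc p" using l by (cases l) auto
    have pn: "p < n" using l p by simp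
    have a0: "a l \<noteq> 0" using a_pos[OF l] by simp
    have level_weight: "level_weight (2 * l - 1) = a l" "level_weight (2 * l) = inverse (a l)"
      by (simp_all add: level_weight_def p)
    \<comment> \<open>\<open>branch\<close> sums one coordinate more than an even level has
      particles; that coordinate is 0.\<close>
    have sz: "psize (Suc l) (Z (2 * l)) = psize l (Z (2 * l))"
      using out[of "2 * l" l] l by (simp add: psize_def)
    have A: "link Z (2 * l - 1) = a l powi (int (psize l (Z (2 * l - 1))) - int (psize (l - 1) (Z (2 * l - 2)))) *
        (\<Prod>i=1..p. ?g (2 * l - 1) i)"
      unfolding branch_def level_weight by (simp add: p)
    have B: "link Z (2 * l) = inverse (a l) powi (int (psize l (Z (2 * l))) - int (psize l (Z (2 * l - 1)))) *
        ((\<Prod>i=1..p. ?g (2 * l) i) * ?g (2 * l) l)"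
      unfolding branch_def level_weight using sz by (simp add: p)
    have pw: "a l powi (int (psize l (Z (2 * l - 1))) - int (psize (l - 1) (Z (2 * l - 2)))) *
       inverse (a l) powi (int (psize l (Z (2 * l))) - int (psize l (Z (2 * l - 1)))) =
       a l powi (2 * int (psize l (Z (2 * l - 1))) - int (psize l (Z (2 * l))) - int (psize (l - 1) (Z (2 * l - 2))))"
      unfolding power_int_inverse power_int_minus[symmetric]
      using a0 by (subst power_int_add[symmetric]) (simp_all add: algebra_simps)
    have g1: "qbinomial q (Z (2 * l - 1) i - Z (2 * l - 1) (i + 1)) (Z (2 * l - 1) i - Z (2 * l - 2) i) = ?g (2 * l - 1) i"
      if "i \<in> {1..p}" for i
      using gap[of "2 * p" i] that pn by (simp add: p)
    have g2: "qbinomial q (Z (2 * l) i - Z (2 * l) (i + 1)) (Z (2 * l) i - Z (2 * l - 1) i) = ?g (2 * l) i"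
      if "i \<in> {1..l}" for i
      using gap[of "Suc (2 * p)" i] that pn by (simp add: p)
    have g3: "qbinomial q (Z (2 * l) l) (Z (2 * l) l - Z (2 * l - 1) l) = ?g (2 * l) l"
      using g2[of l] out[of "2 * l" l] l by simp
    have "(\<Prod>i=1..l - 1.
        qbinomial q (Z (2 * l - 1) i - Z (2 * l - 1) (i + 1)) (Z (2 * l - 1) i - Z (2 * l - 2) i) *
        qbinomial q (Z (2 * l) i - Z (2 * l) (i + 1)) (Z (2 * l) i - Z (2 * l - 1) i)) =
      (\<Prod>i=1..p. ?g (2 * l - 1) i * ?g (2 * l) i)"
      by (rule prod.cong) (use p g1 g2 in auto)
    then show ?thesis
      unfolding A B pw[symmetric] g3 prod.distrib by (simp only: prod.distrib mult_ac)
  qed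
  then have "pattern_monomial n a Z * kappa n q Z = (\<Prod>l=1..n. link Z (2 * l - 1) * link Z (2 * l))"
    unfolding pattern_monomial_def kappa_def prod.distrib[symmetric] by (intro prod.cong refl)
  also have "\<dots> = weight_above 0 Z"
    unfolding prod_pairs[of "\<lambda>k. link Z k" n, symmetric] weight_above_def by (rule prod.cong) auto
  finally show ?thesis .
qed

text \<open>At a fixed index the entries grow with the level, so they are bounded by those of
  \<open>lam\<close>, hence by \<open>N\<close>.\<close>

lemma patterns_arrays:
  assumes Z: "Z \<in> patterns n" and top: "Z (2 * n) = lam"
  shows "Z \<in> arrays 0"
proof -
  have "Z k i \<le> N" if "k \<le> 2 * n" for k i
    using that
  proof (induction rule: inc_induct)
    case base
    then show ?case using top lam(2) by simp
  next
    case (step k)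
    show ?case
    proof (cases "k = 0 \<or> i = 0")
      case True
      then show ?thesis
        using partitions_outside[OF patterns_level[OF Z, of k], of i] step by auto
    next
      case False
      then have "Z k i \<le> Z (Suc k) i"
        using patterns_interlaced[OF Z, of k] step by (simp add: interlaced_def)
      also have "\<dots> \<le> N" by (rule step)
      finally show ?thesis .
    qed
  qed
  then show ?thesis
    using patterns_level[OF Z] Z top by (auto simp: arrays_def tuples_def patterns_def)
qed

text \<open>A nonzero product has nonzero links, and each link forces its two levels to
  interlace.\<close>

lemma arrays_patterns:
  assumes Z: "Z \<in> arrays 0" and nz: "weight_above 0 Z \<noteq> 0"
  shows "Z \<in> patterns n"
proof -
  have lev: "Z k \<in> partitions ((k + 1) div 2)" if "k \<le> 2 * n" for k
    using Z that by (auto simp: arrays_def tuples_def)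
  have "Z k \<preceq> Z (Suc k)" if k: "k < 2 * n" for k
    unfolding interlaced_def
  proof (intro allI impI)
    fix i :: nat assume i: "1 \<le> i"
    have "link Z j \<noteq> 0" if "j \<in> {0<..2 * n}" for j
      using nz that by (simp add: weight_above_def)
    from this[of "Suc k"] have "link Z (Suc k) \<noteq> 0" using k by simp
    then have b: "branch q (level_weight (Suc k)) ((k + 1) div 2) (Z (Suc k)) (Z k) \<noteq> 0" by simp
    show "Z k i \<le> Z (Suc k) i \<and> Z (Suc k) (i + 1) \<le> Z k i"
    proof (cases "i \<in> {1..(k + 1) div 2}")
      case True
      then show ?thesis using branch_neq_0_interlaced[OF q0 q1 b] by simp
    next
      case False
      then have "Z k i = 0" using partitions_outside[OF lev[of k]] k by simp
      moreover have "Z (Suc k) (i + 1) = 0"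
        using False i k by (intro partitions_outside[OF lev[of "Suc k"]]) auto
      ultimately show ?thesis by simp
    qed
  qed
  moreover have "Z k = (\<lambda>_. 0)" if "k \<notin> {1..2 * n}" for k
  proof (cases "k = 0")
    case True
    then show ?thesis using partitions_outside[OF lev[of 0]] by auto
  next
    case False
    then show ?thesis using Z that by (auto simp: arrays_def)
  qed
  moreover have "Z (2 * l - 1) \<in> partitions l" "Z (2 * l) \<in> partitions l" if "l \<in> {1..n}" for l
    using lev[of "2 * l - 1"] lev[of "2 * l"] that by auto
  ultimately show ?thesis by (auto simp: patterns_def)
qed

lemma sum_kernel_KM:
  "(\<Sum>\<^sub>\<infinity>Z\<in>patterns n. kernel_K n q a lam Z * kernel_M n q a Z Z') = (\<Sum>k=1..2 * n. fresh k)"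
proof -
  have "(\<Sum>\<^sub>\<infinity>Z\<in>patterns n. kernel_K n q a lam Z * kernel_M n q a Z Z') =
      (\<Sum>\<^sub>\<infinity>Z\<in>arrays 0. weight_above 0 Z * kernel_M n q a Z Z')"
  proof (rule infsum_cong_neutral)
    \<comment> \<open>The index sets differ only by zero terms: patterns outside
      \<open>arrays 0\<close> have the wrong top level, arrays that are not patterns have weight 0.
      This makes the sum finite.\<close>
    fix Z assume "Z \<in> patterns n - arrays 0"
    then have "Z (2 * n) \<noteq> lam" using patterns_arrays by auto
    then show "kernel_K n q a lam Z * kernel_M n q a Z Z' = 0" by (simp add: kernel_K_def)
  next
    fix Z assume "Z \<in> arrays 0 - patterns n"
    then show "weight_above 0 Z * kernel_M n q a Z Z' = 0" using arrays_patterns by auto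
  next
    fix Z assume "Z \<in> patterns n \<inter> arrays 0"
    then show "kernel_K n q a lam Z * kernel_M n q a Z Z' = weight_above 0 Z * kernel_M n q a Z Z'"
      by (simp add: kernel_K_def weight_patterns arrays_def)
  qed
  also have "\<dots> = (\<Sum>Z\<in>arrays 0. weight_above 0 Z * kernel_M n q a Z Z')"
    by (simp add: finite_arrays)
  also have "\<dots> = (\<Sum>Z\<in>arrays 0. \<Sum>k=1..2 * n. level_weight k * (weight_above 0 Z * right_prob k 1 Z))"
    unfolding kernel_M_eq sum_distrib_left by (intro sum.cong refl) (simp only: mult_ac)
  also have "\<dots> = (\<Sum>k=1..2 * n. fresh k)"
    unfolding fresh_def sum_distrib_left by (rule sum.swap)
  finally show ?thesis .
qed

lemma sum_kernel_LK:
  "(\<Sum>\<^sub>\<infinity>mu\<in>partitions n. kernel_L n q lam mu * kernel_K n q a mu Z') =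
    kernel_L n q lam (Z' (2 * n)) * weight_above 0 Z'"
proof -
  have "Z' (2 * n) \<in> partitions n" using patterns_level[OF Z'(1), of "2 * n"] by simp
  then have "(\<Sum>\<^sub>\<infinity>mu\<in>partitions n. kernel_L n q lam mu * kernel_K n q a mu Z') =
      (\<Sum>\<^sub>\<infinity>mu\<in>{Z' (2 * n)}. kernel_L n q lam mu * kernel_K n q a mu Z')"
    by (intro infsum_cong_neutral) (auto simp: kernel_K_def)
  then show ?thesis by (simp add: kernel_K_def weight_patterns[OF Z'(1)])
qed

end

theorem theorem3:
  fixes n :: nat and q :: real and a :: "nat \<Rightarrow> real"
    and lam :: "nat \<Rightarrow> nat" and Z' :: pattern
  assumes "n \<ge> 1" and "0 < q" and "q < 1"
    and "\<And>i. i \<in> {1..n} \<Longrightarrow> a i > 0"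
    and "lam \<in> partitions n" and "Z' \<in> patterns n"
  shows "(\<Sum>\<^sub>\<infinity>Z\<in>patterns n. kernel_K n q a lam Z * kernel_M n q a Z Z') =
         (\<Sum>\<^sub>\<infinity>mu\<in>partitions n. kernel_L n q lam mu * kernel_K n q a mu Z')"
proof -
  \<comment> \<open>\<open>lam\<close> and \<open>Z'\<close> take finitely many values, which yields
    the common bound \<open>N\<close> required by \<open>level_sums\<close>.\<close>
  have "range lam \<subseteq> insert 0 (lam ` {1..n})"
    using partitions_outside[OF assms(5)] by fastforce
  moreover have "(\<Union>k. range (Z' k)) \<subseteq> insert 0 (\<Union>k\<in>{1..2 * n}. Z' k ` {1..n})"
  proof clarify
    fix k i assume "Z' k i \<notin> (\<Union>k\<in>{1..2 * n}. Z' k ` {1..n})"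
    then have "k \<notin> {1..2 * n} \<or> i \<notin> {1..n}" by blast
    then show "Z' k i = 0"
    proof
      assume "k \<notin> {1..2 * n}"
      then show ?thesis using assms(6) by (simp add: patterns_def)
    next
      assume i: "i \<notin> {1..n}"
      show ?thesis
      proof (cases "k \<le> 2 * n")
        case True
        then show ?thesis
          using partitions_outside[OF patterns_level[OF assms(6)], of k i] i by auto
      next
        case False
        then show ?thesis using assms(6) by (simp add: patterns_def)
      qed
    qed
  qed
  ultimately have "finite (range lam \<union> (\<Union>k. range (Z' k)))"
    by (intro finite_UnI) (erule finite_subset, simp)+
  then obtain N where N: "\<forall>m\<in>range lam \<union> (\<Union>k. range (Z' k)). m \<le> N"
    using finite_nat_set_iff_bounded_le by auto
  have "lam i \<le> N" "Z' k i \<le> N" for k i using N by blast+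
  note N = this
  interpret level_sums n q a lam Z' N
    using assms N by unfold_locales auto
  show ?thesis
    using sum_kernel_KM sum_kernel_LK flow_top[OF assms(1)] flow_eq_fresh[of "2 * n"] by simp
qed

end
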